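(* Let $g \in \mathcal{S}_d^n$ be computed by a skew arithmetic circuit $C$, and let $X = (\ell_{i,j})_{i,j \in [d]}$ be a $d \times d$ symbolic matrix whose entries $\ell_{i,j}$ are homogeneous linear forms in $\mathcal{S}_1^n$. Then, given $C$ and $X$, the quantity $\langle \det X, g \rangle$ can be computed with $4^d \, |C| \, \mathrm{poly}(d)$ arithmetic operations.
   Context: $\mathcal{S}_d^n = \mathbb{R}[x_1,\ldots,x_n]_d$ denotes the vector space of homogeneous polynomials of degree $d$ in $n$ variables with real coefficients. The apolar inner product on $\mathcal{S}_d^n$ is $\langle f, g\rangle := f(\partial/\partial x_1, \ldots, \partial/\partial x_n)\, g$, i.e. the scalar obtained by applying the differential operator obtained from $f$ by substituting $\partial/\partial x_i$ for $x_i$ to $g$. An arithmetic circuit is skew if at each multiplication gate one of the two operands is an input variable or a scalar. $|C|$ denotes the total number of gates of $C$. A linear form $\ell_{i,j}$ is given by its coefficient vector. *)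

theory Defs
  imports
    "HOL-Library.Poly_Mapping"
    "Jordan_Normal_Form.Determinant"
begin

section \<open>Real polynomials in the variables \<open>x\<^sub>0, x\<^sub>1, \<dots>\<close>\<close>

type_synonym monom = "nat \<Rightarrow>\<^sub>0 nat"
type_synonym mpoly = "monom \<Rightarrow>\<^sub>0 real"

definition PVar :: "nat \<Rightarrow> mpoly" where
  "PVar i = Poly_Mapping.single (Poly_Mapping.single i 1) 1"

definition PConst :: "real \<Rightarrow> mpoly" where
  "PConst c = Poly_Mapping.single 0 c"

definition mdegree :: "monom \<Rightarrow> nat" where
  "mdegree m = (\<Sum>i\<in>Poly_Mapping.keys m. Poly_Mapping.lookup m i)"

definition forms :: "nat \<Rightarrow> nat \<Rightarrow> mpoly set" where
  "forms n d = {f. \<forall>m\<in>Poly_Mapping.keys f. Poly_Mapping.keys m \<subseteq> {..<n} \<and> mdegree m = d}"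


section \<open>The apolar inner product\<close>

text \<open>If \<open>x\<^sub>i\<close> does not occur in \<open>m\<close>, the truncated difference is harmless since the
  coefficient is \<open>0\<close>.\<close>

definition partial :: "nat \<Rightarrow> mpoly \<Rightarrow> mpoly" where
  "partial i f = (\<Sum>m\<in>Poly_Mapping.keys f.
     Poly_Mapping.single (m - Poly_Mapping.single i 1)
       (real (Poly_Mapping.lookup m i) * Poly_Mapping.lookup f m))"

definition partial_monom :: "monom \<Rightarrow> mpoly \<Rightarrow> mpoly" where
  "partial_monom m = fold (\<lambda>i. partial i ^^ Poly_Mapping.lookup m i)
     (sorted_list_of_set (Poly_Mapping.keys m))"

definition diff_op :: "mpoly \<Rightarrow> mpoly \<Rightarrow> mpoly" where
  "diff_op f g = (\<Sum>m\<in>Poly_Mapping.keys f. PConst (Poly_Mapping.lookup f m) * partial_monom m g)"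

text \<open>For two forms of the same degree, \<open>diff_op f g\<close> is a constant polynomial
  (lemma \<open>diff_op_forms\<close> below); \<open>apolar\<close> extracts that constant.\<close>

definition apolar :: "mpoly \<Rightarrow> mpoly \<Rightarrow> real" where
  "apolar f g = Poly_Mapping.lookup (diff_op f g) 0"

lemma mdegree_superset:
  assumes "finite A" "Poly_Mapping.keys m \<subseteq> A"
  shows "mdegree m = (\<Sum>i\<in>A. Poly_Mapping.lookup m i)"
  unfolding mdegree_def
  by (rule sum.mono_neutral_left) (use assms in \<open>auto simp: Poly_Mapping.in_keys_iff\<close>)

lemma keys_minus_subset: "Poly_Mapping.keys (m - k) \<subseteq> Poly_Mapping.keys (m :: monom)"
  by (auto simp: Poly_Mapping.in_keys_iff Poly_Mapping.lookup_minus)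

lemma mdegree_minus_single:
  assumes "Poly_Mapping.lookup m i \<noteq> 0"
  shows "mdegree (m - Poly_Mapping.single i 1) = mdegree m - 1"
proof -
  have i: "i \<in> Poly_Mapping.keys m" using assms by (simp add: Poly_Mapping.in_keys_iff)
  have "mdegree (m - Poly_Mapping.single i 1)
      = (\<Sum>j\<in>Poly_Mapping.keys m. Poly_Mapping.lookup (m - Poly_Mapping.single i 1) j)"
    by (rule mdegree_superset) (simp_all add: keys_minus_subset)
  also have "\<dots> = (Poly_Mapping.lookup m i - 1)
      + (\<Sum>j\<in>Poly_Mapping.keys m - {i}. Poly_Mapping.lookup m j)"
    by (subst sum.remove[OF _ i])
      (auto simp: Poly_Mapping.lookup_minus Poly_Mapping.lookup_single when_def intro!: sum.cong)
  also have "\<dots> = mdegree m - 1"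
    unfolding mdegree_def using assms by (subst sum.remove[OF _ i]) auto
  finally show ?thesis .
qed

lemma forms_0: "0 \<in> forms n d"
  by (simp add: forms_def)

lemma forms_add: "f \<in> forms n d \<Longrightarrow> g \<in> forms n d \<Longrightarrow> f + g \<in> forms n d"
  unfolding forms_def using Poly_Mapping.keys_add[of f g] by blast

lemma forms_sum: "(\<And>x. x \<in> A \<Longrightarrow> f x \<in> forms n d) \<Longrightarrow> sum f A \<in> forms n d"
  by (induction A rule: infinite_finite_induct) (auto simp: forms_0 forms_add)

lemma forms_PConst_mult: "f \<in> forms n d \<Longrightarrow> PConst c * f \<in> forms n d"
  unfolding forms_def PConst_def using Poly_Mapping.keys_mult[of "Poly_Mapping.single 0 c" f]
  by (fastforce split: if_splits)

lemma partial_forms: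
  assumes "f \<in> forms n d"
  shows "partial i f \<in> forms n (d - 1)"
  unfolding partial_def
proof (rule forms_sum)
  fix m assume m: "m \<in> Poly_Mapping.keys f"
  show "Poly_Mapping.single (m - Poly_Mapping.single i 1)
       (real (Poly_Mapping.lookup m i) * Poly_Mapping.lookup f m)
      \<in> forms n (d - 1)"
  proof (cases "Poly_Mapping.lookup m i = 0")
    case False
    have "Poly_Mapping.keys m \<subseteq> {..<n}" "mdegree m = d" using assms m by (auto simp: forms_def)
    then show ?thesis
      using keys_minus_subset[of m "Poly_Mapping.single i 1"] mdegree_minus_single[OF False]
      by (auto simp: forms_def)
  qed (simp add: forms_0)
qed

lemma partial_power_forms:
  "f \<in> forms n d \<Longrightarrow> (partial i ^^ k) f \<in> forms n (d - k)"
proof (induction k)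
  case (Suc k)
  then show ?case using partial_forms[of "(partial i ^^ k) f" n "d - k" i] by simp
qed simp

lemma partial_fold_forms:
  "f \<in> forms n d \<Longrightarrow>
   fold (\<lambda>i. partial i ^^ Poly_Mapping.lookup m i) is f
     \<in> forms n (d - sum_list (map (Poly_Mapping.lookup m) is))"
proof (induction "is" arbitrary: f d)
  case (Cons i "is")
  show ?case
    using Cons.IH[OF partial_power_forms[OF Cons.prems,
        where i = i and k = "Poly_Mapping.lookup m i"]]
    by simp
qed simp

lemma partial_monom_forms:
  assumes "f \<in> forms n d"
  shows "partial_monom m f \<in> forms n (d - mdegree m)"
proof -
  have "sum_list (map (Poly_Mapping.lookup m) (sorted_list_of_set (Poly_Mapping.keys m))) = mdegree m"
    by (simp add: mdegree_def sum_list_distinct_conv_sum_set)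
  then show ?thesis
    using partial_fold_forms[OF assms] unfolding partial_monom_def by metis
qed

lemma diff_op_forms:
  assumes "f \<in> forms n d" "g \<in> forms n d"
  shows "diff_op f g = PConst (apolar f g)"
proof -
  have "diff_op f g \<in> forms n 0"
    unfolding diff_op_def
  proof (intro forms_sum forms_PConst_mult)
    fix m assume "m \<in> Poly_Mapping.keys f"
    then show "partial_monom m g \<in> forms n 0"
      using partial_monom_forms[OF assms(2), of m] assms(1) by (auto simp: forms_def)
  qed
  then have *: "m = 0" if "m \<in> Poly_Mapping.keys (diff_op f g)" for m
    using that by (auto simp: forms_def mdegree_def Poly_Mapping.in_keys_iff intro!: poly_mapping_eqI)
  show ?thesis
    by (rule poly_mapping_eqI)
      (use * in \<open>auto simp: PConst_def apolar_def Poly_Mapping.lookup_single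
          when_def Poly_Mapping.in_keys_iff\<close>)
qed


section \<open>Skew arithmetic circuits\<close>

text \<open>A circuit is a list of gates in topological order: the operands of the \<open>t\<close>-th gate are
  positions smaller than \<open>t\<close>, and the last gate is the output. Its number of gates is the
  length of the list, so input gates are counted.\<close>

datatype gate = GVar nat | GScalar real | GAdd nat nat | GMul nat nat

type_synonym circuit = "gate list"

fun wf_gate :: "nat \<Rightarrow> nat \<Rightarrow> gate \<Rightarrow> bool" where
  "wf_gate n t (GVar i) = (i < n)"
| "wf_gate n t (GScalar c) = True"
| "wf_gate n t (GAdd l r) = (l < t \<and> r < t)"
| "wf_gate n t (GMul l r) = (l < t \<and> r < t)"

definition wf_circuit :: "nat \<Rightarrow> circuit \<Rightarrow> bool" where
  "wf_circuit n C \<longleftrightarrow> C \<noteq> [] \<and> (\<forall>t<length C. wf_gate n t (C ! t))"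

fun is_input :: "gate \<Rightarrow> bool" where
  "is_input (GVar i) = True"
| "is_input (GScalar c) = True"
| "is_input (GAdd l r) = False"
| "is_input (GMul l r) = False"

definition skew :: "circuit \<Rightarrow> bool" where
  "skew C \<longleftrightarrow> (\<forall>l r. GMul l r \<in> set C \<longrightarrow> is_input (C ! l) \<or> is_input (C ! r))"

fun gate_poly :: "mpoly list \<Rightarrow> gate \<Rightarrow> mpoly" where
  "gate_poly vs (GVar i) = PVar i"
| "gate_poly vs (GScalar c) = PConst c"
| "gate_poly vs (GAdd l r) = vs ! l + vs ! r"
| "gate_poly vs (GMul l r) = vs ! l * vs ! r"

definition gate_polys :: "circuit \<Rightarrow> mpoly list" where
  "gate_polys C = foldl (\<lambda>vs G. vs @ [gate_poly vs G]) [] C"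

definition computes :: "circuit \<Rightarrow> mpoly \<Rightarrow> bool" where
  "computes C g \<longleftrightarrow> last (gate_polys C) = g"


section \<open>Arithmetic random access machines over the reals\<close>

text \<open>Programs act on a memory of natural numbers, used for control flow and addressing, and on
  a memory of reals. Nothing flows from the reals to the naturals, so programs cannot branch on
  real data. The only operations on reals are \<open>+\<close>, \<open>-\<close> and \<open>*\<close>, and the only literals are
  integers. The cost of a run is the number of arithmetic operations on reals it performs.\<close>

type_synonym state = "(nat \<Rightarrow> nat) \<times> (nat \<Rightarrow> real)"

datatype nexp =
    NLit nat
  | NMem nexp
  | NAdd nexp nexp
  | NSub nexp nexp
  | NMul nexp nexp
  | NDiv nexp nexp
  | NMod nexp nexp

datatype rexp =
    RLit int
  | RMem nexp
  | RAdd rexp rexp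
  | RSub rexp rexp
  | RMul rexp rexp

datatype com =
    Skip
  | NStore nexp nexp
  | RStore nexp rexp
  | Seq com com
  | Cond nexp com com
  | While nexp com

fun nval :: "nexp \<Rightarrow> state \<Rightarrow> nat" where
  "nval (NLit k) s = k"
| "nval (NMem a) s = fst s (nval a s)"
| "nval (NAdd a b) s = nval a s + nval b s"
| "nval (NSub a b) s = nval a s - nval b s"
| "nval (NMul a b) s = nval a s * nval b s"
| "nval (NDiv a b) s = nval a s div nval b s"
| "nval (NMod a b) s = nval a s mod nval b s"

fun rval :: "rexp \<Rightarrow> state \<Rightarrow> real" where
  "rval (RLit z) s = of_int z"
| "rval (RMem a) s = snd s (nval a s)"
| "rval (RAdd a b) s = rval a s + rval b s"
| "rval (RSub a b) s = rval a s - rval b s"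
| "rval (RMul a b) s = rval a s * rval b s"

fun rops :: "rexp \<Rightarrow> nat" where
  "rops (RLit z) = 0"
| "rops (RMem a) = 0"
| "rops (RAdd a b) = rops a + rops b + 1"
| "rops (RSub a b) = rops a + rops b + 1"
| "rops (RMul a b) = rops a + rops b + 1"

text \<open>\<open>exec P s k s'\<close>: started in \<open>s\<close>, the program \<open>P\<close> halts in \<open>s'\<close> after \<open>k\<close> arithmetic
  operations on reals. Conditions are true iff nonzero.\<close>

inductive exec :: "com \<Rightarrow> state \<Rightarrow> nat \<Rightarrow> state \<Rightarrow> bool" where
  Skip: "exec Skip s 0 s"
| NStore: "exec (NStore a e) s 0 ((fst s)(nval a s := nval e s), snd s)"
| RStore: "exec (RStore a e) s (rops e) (fst s, (snd s)(nval a s := rval e s))"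
| Seq: "exec P s k s' \<Longrightarrow> exec Q s' l s'' \<Longrightarrow> exec (Seq P Q) s (k + l) s''"
| CondTrue: "nval b s \<noteq> 0 \<Longrightarrow> exec P s k s' \<Longrightarrow> exec (Cond b P Q) s k s'"
| CondFalse: "nval b s = 0 \<Longrightarrow> exec Q s k s' \<Longrightarrow> exec (Cond b P Q) s k s'"
| WhileFalse: "nval b s = 0 \<Longrightarrow> exec (While b P) s 0 s"
| WhileTrue: "nval b s \<noteq> 0 \<Longrightarrow> exec P s k s' \<Longrightarrow> exec (While b P) s' l s'' \<Longrightarrow>
    exec (While b P) s (k + l) s''"

inductive_cases SkipE: "exec Skip s k s'"
inductive_cases NStoreE: "exec (NStore a e) s k s'"
inductive_cases RStoreE: "exec (RStore a e) s k s'"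
inductive_cases SeqE: "exec (Seq P Q) s k s'"
inductive_cases CondE: "exec (Cond b P Q) s k s'"
inductive_cases WhileE: "exec (While b P) s k s'"

lemma exec_deterministic:
  "exec P s k s' \<Longrightarrow> exec P s l' t \<Longrightarrow> k = l' \<and> s' = t"
proof (induction arbitrary: l' t rule: exec.induct)
  case (Seq P s k s' Q l s'')
  from Seq.prems obtain k1 k2 u
    where u: "l' = k1 + k2" "exec P s k1 u" "exec Q u k2 t" by (rule SeqE)
  show ?case using Seq.IH(1)[OF u(2)] Seq.IH(2) u by auto
next
  case (WhileTrue b s P k s' l s'')
  from WhileTrue.prems obtain k1 k2 u
    where u: "l' = k1 + k2" "exec P s k1 u" "exec (While b P) u k2 t"
    by (rule WhileE) (use WhileTrue.hyps(1) in auto)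
  show ?case using WhileTrue.IH(1)[OF u(2)] WhileTrue.IH(2) u by auto
next
  case (WhileFalse b s P)
  from WhileFalse.prems show ?case by (rule WhileE) (use WhileFalse.hyps in auto)
next
  case (CondTrue b s P k s' Q)
  from CondTrue.prems CondTrue.hyps(1) have "exec P s l' t" by (elim CondE) simp_all
  then show ?case by (rule CondTrue.IH)
next
  case (CondFalse b s Q k s' P)
  from CondFalse.prems CondFalse.hyps(1) have "exec Q s l' t" by (elim CondE) simp_all
  then show ?case by (rule CondFalse.IH)
qed (elim SkipE NStoreE RStoreE, simp)+


section \<open>The input format\<close>

text \<open>The naturals hold \<open>n\<close>, \<open>d\<close>, \<open>|C|\<close> in cells 0, 1, 2 and the type and operands of gate \<open>t\<close>
  in cells \<open>3 + 3t\<close>, \<open>4 + 3t\<close>, \<open>5 + 3t\<close>. The reals hold the coefficient of \<open>x\<^sub>k\<close> in \<open>\<ell>\<^sub>i\<^sub>j\<close> in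
  cell \<open>(i d + j) n + k\<close>, followed by one cell per gate, which holds the scalar if the gate is a
  scalar. All other cells are \<open>0\<close>.\<close>

fun gate_code :: "gate \<Rightarrow> nat list" where
  "gate_code (GVar i) = [0, i, 0]"
| "gate_code (GScalar c) = [1, 0, 0]"
| "gate_code (GAdd l r) = [2, l, r]"
| "gate_code (GMul l r) = [3, l, r]"

fun gate_scalar :: "gate \<Rightarrow> real" where
  "gate_scalar (GScalar c) = c"
| "gate_scalar (GVar i) = 0"
| "gate_scalar (GAdd l r) = 0"
| "gate_scalar (GMul l r) = 0"

definition nat_input :: "nat \<Rightarrow> nat \<Rightarrow> circuit \<Rightarrow> nat list" where
  "nat_input n d C = [n, d, length C] @ concat (map gate_code C)"

definition real_input :: "nat \<Rightarrow> nat \<Rightarrow> circuit \<Rightarrow> mpoly mat \<Rightarrow> real list" where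
  "real_input n d C X =
     concat (map (\<lambda>i. concat (map (\<lambda>j.
       map (\<lambda>k. Poly_Mapping.lookup (X $$ (i, j)) (Poly_Mapping.single k 1)) [0..<n]) [0..<d])) [0..<d])
     @ map gate_scalar C"

definition memory :: "'a::zero list \<Rightarrow> nat \<Rightarrow> 'a" where
  "memory xs a = (if a < length xs then xs ! a else 0)"

definition input_state :: "nat \<Rightarrow> nat \<Rightarrow> circuit \<Rightarrow> mpoly mat \<Rightarrow> state" where
  "input_state n d C X = (memory (nat_input n d C), memory (real_input n d C X))"

definition result :: "state \<Rightarrow> real" where
  "result s = snd s 0"

end

theory Submission
  imports Defs
begin

text \<open>
  Multiplication by \<open>x\<^sub>i\<close> is adjoint to \<open>\<partial>\<^sub>i\<close> for the apolar product, and \<open>\<partial>\<^sub>i\<close> of a minor of \<open>X\<close>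
  is a signed sum of smaller minors whose weights are the coefficients of \<open>x\<^sub>i\<close> in the entries
  of \<open>X\<close>, since these are linear forms. So the numbers \<open>\<langle>det X[I,J], f\<^sub>t\<rangle>\<close>, where \<open>f\<^sub>t\<close> is the
  polynomial at gate \<open>t\<close> of the skew circuit and \<open>I\<close>, \<open>J\<close> are sets of rows and columns, can be
  tabulated gate by gate. There are \<open>4\<^sup>d\<close> pairs \<open>(I, J)\<close>, and each cell costs at most
  \<open>2 d\<^sup>2 + 1\<close> operations.
\<close>

section \<open>Partial derivatives and the apolar product\<close>

text \<open>Pairing a minor with a product of two arbitrary polynomials would call for derivatives
  of all orders. In a skew circuit one factor is a variable or a scalar, so a single first-order
  derivative or a scaling suffices, and each table row depends only on earlier rows. Intermediate
  gates may be inhomogeneous, so the pairing is treated on the whole polynomial ring, as the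
  weighted coefficient form of \<open>apolar_eq_sum\<close>. A pair of index sets is stored as one
  number with \<open>2 d\<close> bits; pairs of different sizes denote the minor 0, so every number
  below \<open>4 ^ d\<close> is a valid index. The cost of a cell comes from at most
  \<open>d\<^sup>2\<close> terms of an expansion, each with one multiplication and one addition or
  subtraction; the extra 1 covers a plain sum or scaling. Signs are found from bit counts, which are
  naturals, and so cause no real operations.\<close>

abbreviation lookup where "lookup \<equiv> Poly_Mapping.lookup"
abbreviation single where "single \<equiv> Poly_Mapping.single"
abbreviation keys where "keys \<equiv> Poly_Mapping.keys"

text \<open>Each identity proved with this rule is additive in the polynomial, so it only has to be
  checked on terms \<open>single m c\<close>.\<close>

lemma poly_mapping_single_induct [case_names zero add]:
  fixes f :: "'a \<Rightarrow>\<^sub>0 'b::comm_monoid_add"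
  assumes "P 0" and "\<And>m c f. P f \<Longrightarrow> P (single m c + f)"
  shows "P f"
proof (induction f rule: update_induct)
  case const
  show ?case using assms(1) by (simp add: zero_poly_mapping_def[symmetric])
next
  case (update f a b)
  have "Poly_Mapping.update a b f = single a b + f"
    by (rule poly_mapping_eqI)
      (use update in \<open>auto simp: lookup_update lookup_add lookup_single when_def in_keys_iff\<close>)
  then show ?case using update assms(2) by simp
qed

text \<open>Truncated subtraction may also send monomials without \<open>x_i\<close> to
  \<open>m\<close>, but these carry the factor 0. The only contributing preimage is
  \<open>m + single i 1\<close>.\<close>

lemma lookup_partial:
  "lookup (partial i f) m = real (lookup m i + 1) * lookup f (m + single i 1)"
proof -
  let ?m = "m + single i (1::nat)"
  have eq: "k = ?m" if "k - single i 1 = m" "lookup k i \<noteq> 0" for k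
  proof (rule poly_mapping_eqI)
    fix j
    show "lookup k j = lookup ?m j"
      using that by (auto simp: lookup_add lookup_minus lookup_single when_def)
  qed
  have "lookup (partial i f) m =
      (\<Sum>k\<in>keys f. (real (lookup k i) * lookup f k) when k - single i 1 = m)"
    unfolding partial_def by (simp add: lookup_sum lookup_single)
  also have "\<dots> = (\<Sum>k\<in>keys f. if k = ?m then real (lookup m i + 1) * lookup f ?m else 0)"
  proof (rule sum.cong[OF refl])
    fix k
    have m: "?m - single i 1 = m" by simp
    have i: "lookup ?m i = lookup m i + 1" by (simp add: lookup_add)
    show "((real (lookup k i) * lookup f k) when k - single i 1 = m) =
        (if k = ?m then real (lookup m i + 1) * lookup f ?m else 0)"
    proof (cases "k = ?m")
      case True
      then show ?thesis by (simp only: m i) simp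
    next
      case False
      then have "lookup k i = 0 \<or> k - single i 1 \<noteq> m" using eq[of k] by blast
      then show ?thesis using False by (auto simp: when_def)
    qed
  qed
  also have "\<dots> = real (lookup m i + 1) * lookup f ?m"
    by (auto simp: in_keys_iff)
  finally show ?thesis .
qed

lemma partial_0 [simp]: "partial i 0 = 0"
  by (simp add: partial_def)

lemma partial_add: "partial i (f + g) = partial i f + partial i g"
  by (rule poly_mapping_eqI) (simp add: lookup_partial lookup_add algebra_simps)

lemma partial_sum: "partial i (sum f A) = (\<Sum>a\<in>A. partial i (f a))"
  by (induction A rule: infinite_finite_induct) (simp_all add: partial_add)

lemma partial_single:
  "partial i (single m c) = single (m - single i 1) (real (lookup m i) * c)"
  by (simp add: partial_def)

lemma partial_minus: "partial i (- f) = - partial i f"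
  by (rule poly_mapping_eqI) (simp add: lookup_partial)

lemma partial_1 [simp]: "partial i 1 = 0"
  by (simp flip: single_one add: partial_single)

lemma partial_mult_single:
  "partial i (single m c * single k b) =
    partial i (single m c) * single k b + single m c * partial i (single k b)"
proof -
  have 1: "m - single i 1 + k = m + k - single i 1" if "lookup m i \<noteq> 0" for m k :: monom
    using that
    by (intro poly_mapping_eqI) (auto simp: lookup_add lookup_minus lookup_single when_def)
  \<comment> \<open>The exponents can differ only when \<open>x_i\<close> is absent from the
    differentiated factor, and then both coefficients are 0.\<close>
  have "single (m - single i 1 + k) (real (lookup m i) * c * b) =
      single (m + k - single i 1) (real (lookup m i) * c * b)"
    using 1[of m k] by (cases "lookup m i = 0") auto
  moreover have "single (m + (k - single i 1)) (c * (real (lookup k i) * b)) =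
      single (m + k - single i 1) (c * (real (lookup k i) * b))"
    using 1[of k m] by (cases "lookup k i = 0") (auto simp: add.commute)
  ultimately show ?thesis
    by (simp only: partial_single mult_single flip: single_add) (simp add: lookup_add algebra_simps)
qed

lemma partial_mult: "partial i (f * g) = partial i f * g + f * partial i g"
proof (induction f rule: poly_mapping_single_induct)
  case (add m c f)
  have "partial i (single m c * g) = partial i (single m c) * g + single m c * partial i g"
    by (induction g rule: poly_mapping_single_induct)
      (simp_all add: distrib_left partial_add partial_mult_single algebra_simps)
  then show ?case using add by (simp add: distrib_right partial_add algebra_simps)
qed simp

lemma partial_prod:
  assumes "finite A"
  shows "partial i (prod f A) = (\<Sum>a\<in>A. partial i (f a) * prod f (A - {a}))"
  using assms
proof (induction A rule: finite_induct)
  case (insert x A)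
  have "(\<Sum>a\<in>A. partial i (f a) * prod f (insert x A - {a})) =
      f x * (\<Sum>a\<in>A. partial i (f a) * prod f (A - {a}))"
    unfolding sum_distrib_left
  proof (rule sum.cong[OF refl])
    fix a assume "a \<in> A"
    then have "insert x A - {a} = insert x (A - {a})" using insert by auto
    then show "partial i (f a) * prod f (insert x A - {a}) =
        f x * (partial i (f a) * prod f (A - {a}))"
      using insert by (simp add: mult_ac)
  qed
  moreover have "insert x A - {x} = A" using insert by auto
  ultimately show ?case using insert by (simp add: partial_mult)
qed simp

lemma partial_signof_mult: "partial i (signof p * f) = signof p * partial i f"
  by (cases p rule: sign_cases) (simp_all add: partial_minus)

text \<open>The product rule, applied to each Leibniz term, differentiates one row at a time.
  Laplace expansion along the differentiated row then meets the cofactors of \<open>A\<close>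
  itself, because deleting that row removes the only change.\<close>

lemma partial_det:
  assumes A: "A \<in> carrier_mat k k"
  shows "partial i (det A) = (\<Sum>a<k. \<Sum>b<k. partial i (A $$ (a, b)) * cofactor A a b)"
proof -
  define R where "R a = mat k k (\<lambda>(r, c). if r = a then partial i (A $$ (r, c)) else A $$ (r, c))" for a
  have det_R: "det (R a) = (\<Sum>b<k. partial i (A $$ (a, b)) * cofactor A a b)" if "a < k" for a
  proof -
    have "mat_delete (R a) a b = mat_delete A a b" for b
      using A that by (auto simp: mat_delete_def R_def intro!: eq_matI)
    then have "cofactor (R a) a b = cofactor A a b" for b by (simp add: cofactor_def)
    moreover have "R a \<in> carrier_mat k k" by (simp add: R_def)
    ultimately show ?thesis
      using laplace_expansion_row[of "R a" k a] that by (simp add: R_def)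
  qed
  have "partial i (det A) =
      (\<Sum>p | p permutes {0..<k}. signof p * partial i (\<Prod>a=0..<k. A $$ (a, p a)))"
    using A by (simp add: det_def partial_sum partial_signof_mult)
  also have "\<dots> = (\<Sum>p | p permutes {0..<k}. \<Sum>a<k. signof p * (\<Prod>r=0..<k. R a $$ (r, p r)))"
  proof (rule sum.cong[OF refl])
    fix p assume "p \<in> {p. p permutes {0..<k}}"
    then have p: "p r < k" if "r < k" for r
      using that permutes_in_image[of p "{0..<k}" r] by auto
    have "(\<Prod>r=0..<k. R a $$ (r, p r)) =
        partial i (A $$ (a, p a)) * (\<Prod>r\<in>{0..<k} - {a}. A $$ (r, p r))" if "a < k" for a
      using that p by (subst prod.remove[of _ a]) (auto simp: R_def intro!: prod.cong)
    then show "signof p * partial i (\<Prod>a=0..<k. A $$ (a, p a)) =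
        (\<Sum>a<k. signof p * (\<Prod>r=0..<k. R a $$ (r, p r)))"
      by (simp add: partial_prod sum_distrib_left atLeast0LessThan)
  qed
  also have "\<dots> = (\<Sum>a<k. det (R a))"
    by (subst sum.swap) (simp add: det_def R_def)
  finally show ?thesis by (simp add: det_R)
qed

section \<open>The apolar product as a weighted form on coefficients\<close>

definition mfact :: "monom \<Rightarrow> real" where
  "mfact m = (\<Prod>i\<in>keys m. fact (lookup m i))"

lemma mfact_superset:
  assumes "finite A" "keys m \<subseteq> A"
  shows "mfact m = (\<Prod>i\<in>A. fact (lookup m i))"
  unfolding mfact_def
  by (rule prod.mono_neutral_left) (use assms in \<open>auto simp: in_keys_iff\<close>)

lemma mfact_add_single: "mfact (m + single i 1) = real (lookup m i + 1) * mfact m"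
proof -
  let ?A = "insert i (keys m)"
  have "mfact (m + single i 1) = (\<Prod>j\<in>?A. fact (lookup (m + single i 1) j))"
    by (rule mfact_superset) (use keys_add[of m "single i 1"] in auto)
  also have "\<dots> = (\<Prod>j\<in>?A. (if j = i then real (lookup m i + 1) else 1) * fact (lookup m j))"
    by (rule prod.cong) (auto simp: lookup_add lookup_single when_def)
  also have "\<dots> = real (lookup m i + 1) * mfact m"
    by (subst prod.distrib) (simp add: mfact_superset[of ?A m] prod.delta subset_insertI)
  finally show ?thesis .
qed

lemma lookup_partial_power:
  assumes "lookup m i = 0"
  shows "lookup ((partial i ^^ k) f) m = fact k * lookup f (m + single i k)"
proof -
  \<comment> \<open>Peeling off one derivative raises the exponent of \<open>x_i\<close>, so the
    induction needs an arbitrary exponent \<open>l\<close>. The factor \<open>fact l\<close> avoids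
    the quotient of \<open>fact (k + l)\<close> by \<open>fact l\<close>.\<close>
  have "lookup ((partial i ^^ k) f) (m + single i l) * fact l =
      fact (k + l) * lookup f (m + single i (k + l))" for l
  proof (induction k arbitrary: l)
    case (Suc k)
    have "lookup ((partial i ^^ Suc k) f) (m + single i l) * fact l =
        lookup ((partial i ^^ k) f) (m + single i (Suc l)) * fact (Suc l)"
      using assms by (simp add: lookup_partial lookup_add add.assoc algebra_simps flip: single_add)
    then show ?case using Suc.IH[of "Suc l"] by simp
  qed simp
  from this[of 0] show ?thesis by simp
qed

lemma lookup_partial_monom: "lookup (partial_monom m f) 0 = mfact m * lookup f m"
proof -
  have "lookup (fold (\<lambda>i. partial i ^^ lookup m i) is f) 0 =
      (\<Prod>i\<in>set is. fact (lookup m i)) * lookup f (\<Sum>i\<in>set is. single i (lookup m i))"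
    if "distinct is" for "is"
    using that
  proof (induction "is" arbitrary: f)
    case (Cons i "is")
    \<comment> \<open>Distinctness keeps \<open>x_i\<close> out of the monomial of the remaining
      variables, as \<open>lookup_partial_power\<close> demands.\<close>
    have "lookup (\<Sum>j\<in>set is. single j (lookup m j)) i = 0"
      using Cons.prems by (auto simp: lookup_sum lookup_single when_def intro!: sum.neutral)
    then show ?case using Cons by (simp add: lookup_partial_power add.commute)
  qed simp
  moreover have "(\<Sum>i\<in>keys m. single i (lookup m i)) = m"
    by (rule poly_mapping_eqI) (auto simp: lookup_sum lookup_single when_def in_keys_iff)
  ultimately show ?thesis by (simp add: partial_monom_def mfact_def)
qed

lemma lookup_PConst_mult: "lookup (PConst c * f) m = c * lookup f m"
  unfolding PConst_def mult_map_scale_conv_mult[symmetric]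
  by (simp add: Poly_Mapping.map.rep_eq when_def)

text \<open>Monomials are orthogonal and \<open>m\<close> has square norm \<open>mfact m\<close>.
  The index set may exceed the support, so that several polynomials can share one sum.\<close>

lemma apolar_eq_sum:
  assumes "finite A" "keys f \<subseteq> A"
  shows "apolar f g = (\<Sum>m\<in>A. lookup f m * mfact m * lookup g m)"
proof -
  have "apolar f g = (\<Sum>m\<in>keys f. lookup f m * mfact m * lookup g m)"
    by (simp add: apolar_def diff_op_def lookup_sum lookup_PConst_mult lookup_partial_monom mult.assoc)
  also have "\<dots> = (\<Sum>m\<in>A. lookup f m * mfact m * lookup g m)"
    by (rule sum.mono_neutral_left) (use assms in \<open>auto simp: in_keys_iff\<close>)
  finally show ?thesis .
qed

lemma apolar_0_left [simp]: "apolar 0 g = 0"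
  by (simp add: apolar_eq_sum[of "{}"])

lemma apolar_add_left: "apolar (f + f') g = apolar f g + apolar f' g"
proof -
  let ?A = "keys f \<union> keys f'"
  have "apolar (f + f') g = (\<Sum>m\<in>?A. lookup (f + f') m * mfact m * lookup g m)"
    by (rule apolar_eq_sum) (simp_all add: keys_add)
  then show ?thesis
    by (simp add: apolar_eq_sum[of ?A] lookup_add algebra_simps sum.distrib)
qed

lemma apolar_sum_left: "apolar (sum f A) g = (\<Sum>a\<in>A. apolar (f a) g)"
  by (induction A rule: infinite_finite_induct) (simp_all add: apolar_add_left)

lemma apolar_single_left: "apolar (single m c) g = c * mfact m * lookup g m"
  by (subst apolar_eq_sum[of "{m}"]) auto

lemma apolar_PConst_mult_left: "apolar (PConst c * f) g = c * apolar f g"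
proof (induction f rule: poly_mapping_single_induct)
  case (add m b f)
  then show ?case
    by (simp add: apolar_add_left distrib_left apolar_single_left PConst_def mult_single)
qed simp

lemma apolar_add_right: "apolar f (g + g') = apolar f g + apolar f g'"
  by (simp add: apolar_eq_sum[OF finite_keys order_refl] lookup_add algebra_simps sum.distrib)

lemma apolar_PConst_mult_right: "apolar f (PConst c * g) = c * apolar f g"
  by (simp add: apolar_eq_sum[OF finite_keys order_refl] lookup_PConst_mult sum_distrib_left
      mult.left_commute)

lemma apolar_1_right: "apolar f 1 = lookup f 0"
proof -
  have "apolar f 1 = (\<Sum>m\<in>keys f. if m = 0 then lookup f 0 else 0)"
    unfolding apolar_eq_sum[OF finite_keys order_refl]
    by (rule sum.cong) (auto simp: lookup_one mfact_def)
  then show ?thesis by (simp add: in_keys_iff)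
qed

lemma lookup_PVar_mult_add: "lookup (PVar i * g) (m + single i 1) = lookup g m"
  unfolding PVar_def
  by (induction g rule: poly_mapping_single_induct)
    (simp_all add: distrib_left lookup_add mult_single lookup_single add.commute)

lemma lookup_PVar_mult_0:
  assumes "lookup m i = 0"
  shows "lookup (PVar i * g) m = 0"
  unfolding PVar_def
proof (induction g rule: poly_mapping_single_induct)
  case (add k c g)
  have "single i 1 + k \<noteq> m"
    using assms by (metis add_is_0 lookup_add lookup_single_eq one_neq_zero)
  then show ?case using add by (simp add: distrib_left lookup_add mult_single lookup_single)
qed simp

text \<open>On a monomial containing \<open>x_i\<close>, the exponent brought down by the derivative
  is the factor by which the two factorial weights differ; on any other monomial both sides are
  0.\<close>

lemma apolar_PVar_mult_right: "apolar f (PVar i * g) = apolar (partial i f) g"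
proof (induction f rule: poly_mapping_single_induct)
  case (add m c f)
  have "apolar (single m c) (PVar i * g) = apolar (partial i (single m c)) g"
  proof (cases "lookup m i = 0")
    case True
    then show ?thesis by (simp add: apolar_single_left partial_single lookup_PVar_mult_0)
  next
    case False
    define k where "k = m - single i 1"
    have "m = k + single i 1"
      unfolding k_def using False
      by (intro poly_mapping_eqI) (auto simp: lookup_add lookup_minus lookup_single when_def)
    then show ?thesis
      by (simp only: apolar_single_left partial_single lookup_PVar_mult_add mfact_add_single)
        (simp add: lookup_add)
  qed
  then show ?case using add by (simp add: apolar_add_left partial_add)
qed simp

text \<open>A monomial \<open>m + single k 1\<close> of degree 1 forces \<open>m = 0\<close>, so
  only a constant survives.\<close>

lemma partial_linear_form:
  assumes "f \<in> forms n 1"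
  shows "partial k f = PConst (lookup f (single k 1))"
proof (rule poly_mapping_eqI)
  fix m
  show "lookup (partial k f) m = lookup (PConst (lookup f (single k 1))) m"
  proof (cases "m = 0")
    case True
    then show ?thesis by (simp add: lookup_partial PConst_def)
  next
    case False
    then obtain j where j: "lookup m j \<noteq> 0" by (metis lookup_zero poly_mapping_eqI)
    have "m + single k 1 \<notin> keys f"
    proof
      assume "m + single k 1 \<in> keys f"
      then have "mdegree (m + single k 1) = 1" using assms by (auto simp: forms_def)
      moreover have "mdegree (m + single k 1) =
          (\<Sum>j\<in>insert k (keys m). lookup (m + single k 1) j)"
        by (rule mdegree_superset) (use keys_add[of m "single k 1"] in auto)
      moreover have "\<dots> = (\<Sum>j\<in>insert k (keys m). lookup m j) + 1"
        by (simp add: lookup_add sum.distrib lookup_single when_def)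
      ultimately have "(\<Sum>j\<in>insert k (keys m). lookup m j) = 0" by simp
      then show False using j by (auto simp: in_keys_iff)
    qed
    then show ?thesis using False by (simp add: lookup_partial PConst_def in_keys_iff lookup_single)
  qed
qed

text \<open>The constant coefficient is evaluation at the origin; exponents in the naturals add up
  to 0 only if both are 0.\<close>

lemma lookup_mult_0: "lookup (f * g) 0 = lookup f 0 * lookup g (0::monom)"
proof (induction f rule: poly_mapping_single_induct)
  case (add m c f)
  have z: "m + k = 0 \<longleftrightarrow> m = 0 \<and> k = 0" for k :: monom
    by (auto simp: poly_mapping_eq_iff fun_eq_iff lookup_add)
  have "lookup (single m c * g) 0 = lookup (single m c) 0 * lookup g 0"
    by (induction g rule: poly_mapping_single_induct)
      (auto simp: distrib_left lookup_add mult_single lookup_single z when_def)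
  then show ?case using add by (simp add: distrib_right lookup_add)
qed simp

section \<open>Minors\<close>

text \<open>Lists instead of sets, because a cofactor sign depends on the position of a row or
  column within the selection.\<close>

definition list_submat :: "'a mat \<Rightarrow> nat list \<Rightarrow> nat list \<Rightarrow> 'a mat" where
  "list_submat X xs ys = mat (length xs) (length ys) (\<lambda>(i, j). X $$ (xs ! i, ys ! j))"

definition delete_nth :: "nat \<Rightarrow> 'a list \<Rightarrow> 'a list" where
  "delete_nth k xs = take k xs @ drop (Suc k) xs"

lemma length_delete_nth: "k < length xs \<Longrightarrow> length (delete_nth k xs) = length xs - 1"
  by (simp add: delete_nth_def)

lemma nth_delete_nth:
  assumes "k < length xs" "i < length xs - 1"
  shows "delete_nth k xs ! i = xs ! (if i < k then i else Suc i)"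
  using assms by (auto simp: delete_nth_def nth_append)

lemma mat_delete_list_submat:
  assumes "a < length xs" "b < length ys"
  shows "mat_delete (list_submat X xs ys) a b = list_submat X (delete_nth a xs) (delete_nth b ys)"
  by (rule eq_matI) (use assms in
    \<open>auto simp: mat_delete_def list_submat_def length_delete_nth nth_delete_nth\<close>)

text \<open>Selections of different lengths get the value 0, and removing one row and one column
  keeps them different. The expansion therefore holds for all pairs.\<close>

definition list_minor :: "mpoly mat \<Rightarrow> nat list \<Rightarrow> nat list \<Rightarrow> mpoly" where
  "list_minor X xs ys = (if length xs = length ys then det (list_submat X xs ys) else 0)"

lemma PConst_mult_PConst: "PConst a * PConst b = PConst (a * b)"
  by (simp add: PConst_def mult_single)

lemma PConst_1: "PConst 1 = 1"
  by (simp add: PConst_def)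

lemma minus_one_power_PConst: "(- 1) ^ k = PConst ((- 1) ^ k)"
proof (induction k)
  case (Suc k)
  have "PConst (- 1) = - 1" by (simp add: PConst_def single_uminus)
  then show ?case using Suc by (simp only: power_Suc PConst_mult_PConst[symmetric])
qed (simp add: PConst_1)

lemma partial_list_minor:
  assumes "\<And>x y. x \<in> set xs \<Longrightarrow> y \<in> set ys \<Longrightarrow> X $$ (x, y) \<in> forms n 1"
  shows "partial i (list_minor X xs ys) = (\<Sum>a<length xs. \<Sum>b<length ys.
    PConst ((- 1) ^ (a + b) * lookup (X $$ (xs ! a, ys ! b)) (single i 1)) *
    list_minor X (delete_nth a xs) (delete_nth b ys))"
proof (cases "length xs = length ys")
  case True
  let ?A = "list_submat X xs ys"
  have "?A \<in> carrier_mat (length ys) (length ys)" using True by (simp add: list_submat_def)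
  then have "partial i (list_minor X xs ys) =
      (\<Sum>a<length ys. \<Sum>b<length ys. partial i (?A $$ (a, b)) * cofactor ?A a b)"
    using True by (simp add: list_minor_def partial_det)
  also have "\<dots> = (\<Sum>a<length ys. \<Sum>b<length ys.
      PConst ((- 1) ^ (a + b) * lookup (X $$ (xs ! a, ys ! b)) (single i 1)) *
      list_minor X (delete_nth a xs) (delete_nth b ys))"
  proof (intro sum.cong refl)
    fix a b assume "a \<in> {..<length ys}" "b \<in> {..<length ys}"
    then have ab: "a < length xs" "b < length ys" using True by simp_all
    then have "partial i (?A $$ (a, b)) = PConst (lookup (X $$ (xs ! a, ys ! b)) (single i 1))"
      using partial_linear_form[OF assms] by (simp add: list_submat_def)
    moreover have "cofactor ?A a b =
        PConst ((- 1) ^ (a + b)) * list_minor X (delete_nth a xs) (delete_nth b ys)"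
      using ab True by (simp add: cofactor_def mat_delete_list_submat list_minor_def
          length_delete_nth minus_one_power_PConst)
    ultimately show "partial i (?A $$ (a, b)) * cofactor ?A a b =
        PConst ((- 1) ^ (a + b) * lookup (X $$ (xs ! a, ys ! b)) (single i 1)) *
        list_minor X (delete_nth a xs) (delete_nth b ys)"
      by (simp add: mult_ac flip: PConst_mult_PConst)
  qed
  finally show ?thesis using True by simp
next
  case False
  then have "list_minor X (delete_nth a xs) (delete_nth b ys) = 0"
    if "a < length xs" "b < length ys" for a b
    using that by (auto simp: list_minor_def length_delete_nth)
  then show ?thesis using False by (simp add: list_minor_def)
qed

lemma lookup_linear_form_0: "f \<in> forms n 1 \<Longrightarrow> lookup f 0 = 0"
proof (rule ccontr)
  assume "f \<in> forms n 1" "lookup f 0 \<noteq> 0"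
  then have "mdegree 0 = 1" by (auto simp: forms_def in_keys_iff)
  then show False by (simp add: mdegree_def)
qed

text \<open>In the expansion along the first row every term has an entry without constant
  coefficient as factor. Only the empty determinant, which is 1, escapes this. These are the start
  values of the table.\<close>

lemma lookup_list_minor_0:
  assumes "\<And>x y. x \<in> set xs \<Longrightarrow> y \<in> set ys \<Longrightarrow> X $$ (x, y) \<in> forms n 1"
  shows "lookup (list_minor X xs ys) 0 = (if xs = [] \<and> ys = [] then 1 else 0)"
proof (cases "length xs = length ys \<and> xs \<noteq> []")
  case True
  let ?A = "list_submat X xs ys"
  have "det ?A = (\<Sum>b<length ys. ?A $$ (0, b) * cofactor ?A 0 b)"
    by (rule laplace_expansion_row) (use True in \<open>auto simp: list_submat_def\<close>)
  moreover have "lookup (?A $$ (0, b)) 0 = 0" if "b < length ys" for b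
  proof -
    have "ys \<noteq> []" using that by auto
    then have "?A $$ (0, b) = X $$ (xs ! 0, ys ! b)" "0 < length xs"
      using that True by (auto simp: list_submat_def)
    then show ?thesis using that lookup_linear_form_0[OF assms] by simp
  qed
  ultimately show ?thesis using True by (simp add: list_minor_def lookup_sum lookup_mult_0)
next
  case False
  then show ?thesis by (auto simp: list_minor_def list_submat_def)
qed

text \<open>Positions in the filtered list are traded for the original indices: the position of a
  selected \<open>a\<close> is the number of selected indices below \<open>a\<close>.\<close>

lemma sum_filter_upt:
  "(\<Sum>k<length (filter Q [0..<d]). f (filter Q [0..<d] ! k) k) =
   (\<Sum>a<d. if Q a then f a (length (filter Q [0..<a])) else (0::'a::comm_monoid_add))"
  by (induction d) (simp_all add: nth_append)

lemma delete_nth_filter_upt: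
  assumes "a < d" "Q a"
  shows "delete_nth (length (filter Q [0..<a])) (filter Q [0..<d]) = filter (\<lambda>i. Q i \<and> i \<noteq> a) [0..<d]"
proof -
  have "[0..<d] = [0..<a] @ a # [Suc a..<d]"
    using assms(1) upt_add_eq_append[of 0 a "d - a"] by (simp add: upt_conv_Cons)
  moreover have "filter (\<lambda>i. Q i \<and> i \<noteq> a) [0..<a] = filter Q [0..<a]"
    "filter (\<lambda>i. Q i \<and> i \<noteq> a) [Suc a..<d] = filter Q [Suc a..<d]"
    by (auto intro!: filter_cong)
  ultimately show ?thesis using assms(2) by (simp add: delete_nth_def)
qed

section \<open>Index sets as bit masks\<close>

lemma bit_div_power: "bit (m div 2 ^ d) a \<longleftrightarrow> bit m (d + a)" for m :: nat
  by (simp add: bit_iff_odd power_add div_mult2_eq)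

text \<open>Subtracting a power of two that is present causes no borrow. This lets the machine,
  which has no bit operations, remove an element from a set.\<close>

lemma bit_minus_power:
  fixes m :: nat
  assumes "bit m a"
  shows "bit (m - 2 ^ a) i \<longleftrightarrow> bit m i \<and> i \<noteq> a"
proof -
  have "unset_bit a m = m - 2 ^ a"
    using assms
  proof (induction a arbitrary: m)
    case 0
    then show ?case by (simp add: unset_bit_0 bit_0 odd_iff_mod_2_eq_one minus_mod_eq_mult_div[symmetric])
  next
    case (Suc a)
    have "unset_bit (Suc a) m = m mod 2 + 2 * (m div 2 - 2 ^ a)"
      using Suc by (simp add: unset_bit_Suc bit_Suc)
    moreover have "2 ^ a \<le> m div 2"
      using Suc.prems by (simp add: bit_Suc) (metis bit_iff_odd div_less even_zero not_le)
    ultimately show ?case unfolding power_Suc by presburger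
  qed
  then show ?thesis using bit_unset_bit_iff[of a m i] by auto
qed

text \<open>The recursion has the form in which the program fills its table of bit counts.\<close>

fun popcount :: "nat \<Rightarrow> nat" where
  "popcount m = (if m = 0 then 0 else m mod 2 + popcount (m div 2))"

declare popcount.simps [simp del]

text \<open>The low bits of a mask count the selected indices below \<open>a\<close>, hence give the
  position of \<open>a\<close>; cofactor signs become parities of bit counts.\<close>

lemma popcount_mod_power: "popcount (m mod 2 ^ a) = length (filter (bit m) [0..<a])"
proof (induction a arbitrary: m)
  case 0
  then show ?case by (simp add: popcount.simps)
next
  case (Suc a)
  have "popcount k = k mod 2 + popcount (k div 2)" for k
    by (cases "k = 0") (simp_all add: popcount.simps[of k] popcount.simps[of 0])
  then have "popcount (m mod 2 ^ Suc a) =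
      (m mod 2 ^ Suc a) mod 2 + popcount ((m mod 2 ^ Suc a) div 2)" .
  moreover have "(m mod 2 ^ Suc a) mod 2 = m mod 2" by (simp add: mod_mod_cancel)
  moreover have "(m mod 2 ^ Suc a) div 2 = (m div 2) mod 2 ^ a"
    by (simp add: mod_mult2_eq)
  moreover have "[0..<Suc a] = 0 # map Suc [0..<a]"
    by (metis map_Suc_upt upt_conv_Cons zero_less_Suc)
  ultimately show ?case
    using Suc[of "m div 2"] by (simp add: filter_map o_def bit_0 bit_Suc[abs_def] odd_iff_mod_2_eq_one)
qed

text \<open>The bits \<open>0, \<dots>, d - 1\<close> of \<open>p\<close> select the columns of the minor and the bits
  \<open>d, \<dots>, 2d - 1\<close> its rows, so \<open>p < 4 ^ d\<close> ranges over all pairs of subsets of \<open>{..<d}\<close>.\<close>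

definition mask_minor :: "nat \<Rightarrow> mpoly mat \<Rightarrow> nat \<Rightarrow> mpoly" where
  "mask_minor d X p = list_minor X (filter (bit (p div 2 ^ d)) [0..<d]) (filter (bit p) [0..<d])"

text \<open>This is the recurrence that the program evaluates: adjointness turns the variable into a
  derivative of the minor, and the positions and deletions of its expansion are expressed by bit
  counts and subtractions.\<close>

lemma apolar_mask_minor_PVar:
  assumes "\<And>i j. i < d \<Longrightarrow> j < d \<Longrightarrow> X $$ (i, j) \<in> forms n 1"
  shows "apolar (mask_minor d X p) (PVar i * f) = (\<Sum>a<d. \<Sum>b<d.
    if bit p (d + a) \<and> bit p b then
      (- 1) ^ (popcount (p div 2 ^ d mod 2 ^ a) + popcount (p mod 2 ^ b)) *
      (lookup (X $$ (a, b)) (single i 1) * apolar (mask_minor d X (p - 2 ^ (d + a) - 2 ^ b)) f)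
    else 0)"
proof -
  let ?I = "bit (p div 2 ^ d)" and ?J = "bit p"
  let ?xs = "filter ?I [0..<d]" and ?ys = "filter ?J [0..<d]"
  define F where "F x a y b = (- 1) ^ (a + b) * lookup (X $$ (x, y)) (single i 1) *
    apolar (list_minor X (delete_nth a ?xs) (delete_nth b ?ys)) f" for x a y b
  have "apolar (mask_minor d X p) (PVar i * f) =
      (\<Sum>a<length ?xs. \<Sum>b<length ?ys. F (?xs ! a) a (?ys ! b) b)"
    unfolding apolar_PVar_mult_right mask_minor_def
    by (subst partial_list_minor[of _ _ _ n])
      (auto simp: assms[simplified] apolar_sum_left apolar_PConst_mult_left F_def)
  also have "\<dots> = (\<Sum>a<length ?xs. \<Sum>b<d. if ?J b then
      F (?xs ! a) a b (length (filter ?J [0..<b])) else 0)"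
    by (rule sum.cong[OF refl], rule sum_filter_upt)
  also have "\<dots> = (\<Sum>a<d. if ?I a then (\<Sum>b<d. if ?J b then
      F a (length (filter ?I [0..<a])) b (length (filter ?J [0..<b])) else 0) else 0)"
    by (rule sum_filter_upt)
  also have "\<dots> = (\<Sum>a<d. \<Sum>b<d. if bit p (d + a) \<and> bit p b then
      (- 1) ^ (popcount (p div 2 ^ d mod 2 ^ a) + popcount (p mod 2 ^ b)) *
      (lookup (X $$ (a, b)) (single i 1) * apolar (mask_minor d X (p - 2 ^ (d + a) - 2 ^ b)) f)
    else 0)"
  proof (rule sum.cong[OF refl])
    fix a assume a: "a \<in> {..<d}"
    have "F a (length (filter ?I [0..<a])) b (length (filter ?J [0..<b])) =
      (- 1) ^ (popcount (p div 2 ^ d mod 2 ^ a) + popcount (p mod 2 ^ b)) *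
      (lookup (X $$ (a, b)) (single i 1) * apolar (mask_minor d X (p - 2 ^ (d + a) - 2 ^ b)) f)"
      if "b < d" "?I a" "?J b" for b
    proof -
      have pa: "bit p (d + a)" using that by (simp add: bit_div_power)
      \<comment> \<open>Bit \<open>b\<close> survives the first subtraction since
        \<open>b < d\<close>, so the second one also clears a bit that is set.\<close>
      then have pb: "bit (p - 2 ^ (d + a)) b" using that by (simp add: bit_minus_power)
      have bits: "bit (p - 2 ^ (d + a) - 2 ^ b) j \<longleftrightarrow> bit p j \<and> j \<noteq> d + a \<and> j \<noteq> b" for j
        unfolding bit_minus_power[OF pb] bit_minus_power[OF pa] by auto
      have "filter (bit ((p - 2 ^ (d + a) - 2 ^ b) div 2 ^ d)) [0..<d] =
          filter (\<lambda>i. ?I i \<and> i \<noteq> a) [0..<d]"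
        by (rule filter_cong) (use that bits in \<open>auto simp: bit_div_power\<close>)
      moreover have "filter (bit (p - 2 ^ (d + a) - 2 ^ b)) [0..<d] =
          filter (\<lambda>i. ?J i \<and> i \<noteq> b) [0..<d]"
        by (rule filter_cong) (use bits in auto)
      ultimately show ?thesis
        using that a by (simp add: F_def mask_minor_def delete_nth_filter_upt popcount_mod_power)
    qed
    then show "(if ?I a then (\<Sum>b<d. if ?J b then
        F a (length (filter ?I [0..<a])) b (length (filter ?J [0..<b])) else 0) else 0) =
      (\<Sum>b<d. if bit p (d + a) \<and> bit p b then
      (- 1) ^ (popcount (p div 2 ^ d mod 2 ^ a) + popcount (p mod 2 ^ b)) *
      (lookup (X $$ (a, b)) (single i 1) * apolar (mask_minor d X (p - 2 ^ (d + a) - 2 ^ b)) f)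
      else 0)"
      by (auto simp: bit_div_power intro!: sum.cong)
  qed
  finally show ?thesis .
qed

text \<open>One counter \<open>e\<close> for both indices matches the program's single loop and the
  row-by-row storage of the coefficients.\<close>

lemma sum_less_square:
  "(\<Sum>a<d. \<Sum>b<d. f a b) = (\<Sum>e<d * (d::nat). f (e div d) (e mod d) :: 'a::comm_monoid_add)"
proof -
  have "(\<Sum>e<d * d. f (e div d) (e mod d)) = (\<Sum>a<d. \<Sum>e=a * d..<a * d + d. f (e div d) (e mod d))"
    by (simp add: sum.nat_group)
  also have "\<dots> = (\<Sum>a<d. \<Sum>b<d. f a b)"
  proof (rule sum.cong[OF refl])
    fix a
    have "(\<Sum>e=a * d..<a * d + d. f (e div d) (e mod d)) =
        (\<Sum>b=0..<d. f ((b + a * d) div d) ((b + a * d) mod d))"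
      using sum.shift_bounds_nat_ivl[of "\<lambda>e. f (e div d) (e mod d)" 0 "a * d" d]
      by (simp add: add.commute)
    also have "\<dots> = (\<Sum>b<d. f a b)"
      by (auto simp: atLeast0LessThan intro!: sum.cong)
    finally show "(\<Sum>e=a * d..<a * d + d. f (e div d) (e mod d)) = (\<Sum>b<d. f a b)" .
  qed
  finally show ?thesis ..
qed

lemma mask_minor_full:
  assumes "X \<in> carrier_mat d d"
  shows "mask_minor d X (4 ^ d - 1) = det X"
proof -
  have 4: "(4::nat) ^ d = 2 ^ (d + d)" by (simp add: power_add flip: power_mult_distrib)
  have b: "bit (4 ^ d - 1 :: nat) j" if "j < d + d" for j
    using that unfolding 4 mask_eq_exp_minus_1[symmetric] by (simp add: bit_mask_iff)
  have "bit ((4 ^ d - 1) div 2 ^ d :: nat) j" if "j < d" for j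
    using b[of "d + j"] that by (simp add: bit_div_power)
  then have "filter (bit ((4 ^ d - 1) div 2 ^ d :: nat)) [0..<d] = [0..<d]"
    by (simp add: filter_True)
  moreover have "filter (bit (4 ^ d - 1 :: nat)) [0..<d] = [0..<d]"
    using b by (simp add: filter_True)
  moreover have "list_submat X [0..<d] [0..<d] = X"
    by (rule eq_matI) (use assms in \<open>auto simp: list_submat_def\<close>)
  ultimately show ?thesis by (simp add: mask_minor_def list_minor_def)
qed

lemma lookup_mask_minor_0:
  assumes "\<And>i j. i < d \<Longrightarrow> j < d \<Longrightarrow> X $$ (i, j) \<in> forms n 1" and "p < 4 ^ d"
  shows "lookup (mask_minor d X p) 0 = (if p = 0 then 1 else 0)"
proof -
  have 4: "(4::nat) ^ d = 2 ^ (d + d)" by (simp add: power_add flip: power_mult_distrib)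
  let ?xs = "filter (bit (p div 2 ^ d)) [0..<d]" and ?ys = "filter (bit p) [0..<d]"
  \<comment> \<open>Bits below \<open>2 d\<close> would show up in one of the two lists; higher bits
    are excluded by \<open>p < 4 ^ d\<close>.\<close>
  have "p = 0" if "?xs = []" "?ys = []"
  proof (rule bit_eqI)
    fix j
    have "\<not> bit p j"
    proof
      assume j: "bit p j"
      then have "j < d + d" using assms(2) unfolding 4
        by (metis bit_take_bit_iff take_bit_nat_eq_self_iff)
      moreover have "\<not> j < d" using that(2) j by (auto simp: filter_empty_conv)
      moreover have "\<not> (d \<le> j \<and> j < d + d)"
        using that(1) j by (auto simp: filter_empty_conv bit_div_power dest!: bspec[of _ _ "j - d"])
      ultimately show False by simp
    qed
    then show "bit p j \<longleftrightarrow> bit 0 j" by simp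
  qed
  moreover have "lookup (mask_minor d X p) 0 = (if ?xs = [] \<and> ?ys = [] then 1 else 0)"
    unfolding mask_minor_def by (rule lookup_list_minor_0[of _ _ _ n]) (auto simp: assms(1)[simplified])
  ultimately show ?thesis by auto
qed

section \<open>A program and its cost\<close>

text \<open>Total correctness with an upper bound on the cost. Since the postcondition is a
  predicate, it can itself be a \<open>runs\<close> statement about the rest of the program, which
  is how sequences are composed.\<close>

definition runs :: "com \<Rightarrow> state \<Rightarrow> nat \<Rightarrow> (state \<Rightarrow> bool) \<Rightarrow> bool" where
  "runs P s K Q \<longleftrightarrow> (\<exists>k s'. exec P s k s' \<and> k \<le> K \<and> Q s')"

lemma runs_mono: "runs P s K Q \<Longrightarrow> K \<le> L \<Longrightarrow> (\<And>s'. Q s' \<Longrightarrow> R s') \<Longrightarrow> runs P s L R"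
  unfolding runs_def by (meson le_trans)

lemma runs_Skip: "Q s \<Longrightarrow> runs Skip s K Q"
  unfolding runs_def using exec.Skip by blast

lemma runs_NStore: "Q ((fst s)(nval a s := nval e s), snd s) \<Longrightarrow> runs (NStore a e) s K Q"
  unfolding runs_def using exec.NStore by blast

lemma runs_RStore:
  "rops e \<le> K \<Longrightarrow> Q (fst s, (snd s)(nval a s := rval e s)) \<Longrightarrow> runs (RStore a e) s K Q"
  unfolding runs_def using exec.RStore by blast

lemma runs_Seq: "runs P s K (\<lambda>s'. runs Q s' L R) \<Longrightarrow> runs (Seq P Q) s (K + L) R"
  unfolding runs_def by (meson add_mono exec.Seq)

lemma runs_Seq_0: "runs P s 0 (\<lambda>s'. runs Q s' L R) \<Longrightarrow> runs (Seq P Q) s L R"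
  using runs_Seq[of P s 0 Q L R] by simp

lemma runs_Cond:
  assumes "nval b s \<noteq> 0 \<Longrightarrow> runs P s K R" "nval b s = 0 \<Longrightarrow> runs Q s K R"
  shows "runs (Cond b P Q) s K R"
  using assms unfolding runs_def by (metis exec.CondTrue exec.CondFalse)

text \<open>The truncated difference is nonzero exactly while the counter is below the
  bound.\<close>

definition for_loop :: "nexp \<Rightarrow> nexp \<Rightarrow> nexp \<Rightarrow> com \<Rightarrow> com" where
  "for_loop a l b P = Seq (NStore a l)
     (While (NSub b (NMem a)) (Seq P (NStore a (NAdd (NMem a) (NLit 1)))))"

text \<open>Counter address and bound are expressions evaluated anew in every round, so
  \<open>bound\<close> requires the invariant to determine the counter and the bound. The body need
  only restore the invariant after the increment.\<close>

lemma runs_for_loop: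
  assumes init: "Inv l ((fst s)(nval a s := nval lo s), snd s)"
    and bound: "\<And>i s. Inv i s \<Longrightarrow> nval b s = m \<and> nval (NMem a) s = i"
    and step: "\<And>i s. l \<le> i \<Longrightarrow> i < m \<Longrightarrow> Inv i s \<Longrightarrow>
      runs P s K (\<lambda>s'. Inv (Suc i) ((fst s')(nval a s' := Suc (nval (NMem a) s')), snd s'))"
    and fin: "\<And>s. Inv m s \<Longrightarrow> Q s"
    and "l \<le> m"
  shows "runs (for_loop a lo b P) s ((m - l) * K) Q"
proof -
  let ?W = "While (NSub b (NMem a)) (Seq P (NStore a (NAdd (NMem a) (NLit 1))))"
  have loop: "runs ?W s (k * K) Q" if "Inv i s" "k = m - i" "l \<le> i" "i \<le> m" for k i s
    using that
  proof (induction k arbitrary: i s)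
    case 0
    then have "i = m" by simp
    then have "nval (NSub b (NMem a)) s = 0" using bound[OF "0.prems"(1)] by simp
    moreover have "Q s" using 0 fin \<open>i = m\<close> by simp
    ultimately show ?case unfolding runs_def using exec.WhileFalse by blast
  next
    case (Suc k)
    have nz: "nval (NSub b (NMem a)) s \<noteq> 0" using bound[OF Suc.prems(1)] Suc.prems by simp
    have "runs (Seq P (NStore a (NAdd (NMem a) (NLit 1)))) s (K + 0) (Inv (Suc i))"
      by (rule runs_Seq, rule runs_mono[OF step]) (use Suc.prems in \<open>auto intro!: runs_NStore\<close>)
    then obtain k1 s1 where 1:
        "exec (Seq P (NStore a (NAdd (NMem a) (NLit 1)))) s k1 s1" "k1 \<le> K" "Inv (Suc i) s1"
      unfolding runs_def by auto
    have "runs ?W s1 (k * K) Q"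
      by (rule Suc.IH[OF 1(3)]) (use Suc.prems in auto)
    then obtain k2 s2 where "exec ?W s1 k2 s2" "k2 \<le> k * K" "Q s2" unfolding runs_def by auto
    then show ?case
      unfolding runs_def using exec.WhileTrue[OF nz 1(1)] 1(2)
      by (intro exI[of _ "k1 + k2"] exI[of _ s2]) (auto simp: add_mono)
  qed
  show ?thesis
    unfolding for_loop_def
    by (intro runs_Seq_0 runs_NStore loop[OF init]) (use assms(5) in auto)
qed

section \<open>Memory layout and text of the program\<close>

text \<open>Working memory of the program. Behind the input, which ends at \<open>base_addr\<close>, the naturals
  hold four registers, the powers of two up to \<open>2 ^ (2 d)\<close> and the bit counts of the numbers
  below \<open>2 ^ d\<close>. Register 0 is the number of the current cell, 1 is the current matrix entry,
  2 is the input gate that multiplies, and 3 is the row of the other factor. The reals hold, behind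
  the input, a table whose row \<open>t + 1\<close> belongs to gate \<open>t\<close> and has one cell per pair of
  subsets. Row 0 belongs to the constant polynomial 1, so that an input gate is treated as its
  product with row 0.\<close>

definition base_addr :: nexp where
  "base_addr = NAdd (NLit 3) (NMul (NLit 3) (NMem (NLit 2)))"

definition reg_addr :: "nat \<Rightarrow> nexp" where
  "reg_addr k = NAdd base_addr (NLit k)"

abbreviation reg :: "nat \<Rightarrow> nexp" where
  "reg k \<equiv> NMem (reg_addr k)"

definition pow_addr :: "nexp \<Rightarrow> nexp" where
  "pow_addr e = NAdd base_addr (NAdd (NLit 4) e)"

text \<open>The offset skips four registers and the \<open>2 d + 1\<close> powers from
  \<open>2 ^ 0\<close> to \<open>2 ^ (2 d)\<close>.\<close>

definition pop_addr :: "nexp \<Rightarrow> nexp" where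
  "pop_addr e = NAdd base_addr (NAdd (NLit 5) (NAdd (NMul (NLit 2) (NMem (NLit 1))) e))"

text \<open>The last tabulated power, \<open>2 ^ (2 d) = 4 ^ d\<close>.\<close>

definition row_size :: nexp where
  "row_size = NMem (pow_addr (NMul (NLit 2) (NMem (NLit 1))))"

definition coef_addr :: "nexp \<Rightarrow> nexp \<Rightarrow> nexp" where
  "coef_addr e i = NAdd (NMul e (NMem (NLit 0))) i"

definition scalar_addr :: "nexp \<Rightarrow> nexp" where
  "scalar_addr t = coef_addr (NMul (NMem (NLit 1)) (NMem (NLit 1))) t"

definition cell_addr :: "nexp \<Rightarrow> nexp" where
  "cell_addr x = NAdd (scalar_addr (NMem (NLit 2))) x"

definition gate_field :: "nat \<Rightarrow> nexp \<Rightarrow> nexp" where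
  "gate_field j t = NMem (NAdd (NLit (3 + j)) (NMul (NLit 3) t))"

definition pow_table :: com where
  "pow_table = Seq (NStore (pow_addr (NLit 0)) (NLit 1))
     (for_loop (reg_addr 0) (NLit 0) (NMul (NLit 2) (NMem (NLit 1)))
       (NStore (pow_addr (NAdd (reg 0) (NLit 1))) (NMul (NLit 2) (NMem (pow_addr (reg 0))))))"

definition pop_table :: com where
  "pop_table = for_loop (reg_addr 0) (NLit 0) (NMem (pow_addr (NMem (NLit 1))))
     (NStore (pop_addr (reg 0))
       (NAdd (NMod (reg 0) (NLit 2)) (NMem (pop_addr (NDiv (reg 0) (NLit 2))))))"

text \<open>Cells are numbered row by row, so division by the row length yields the row; 1 is
  subtracted because row 0 belongs to no gate.\<close>

definition cur_gate :: nexp where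
  "cur_gate = NSub (NDiv (reg 0) row_size) (NLit 1)"

definition cur_mask :: nexp where
  "cur_mask = NMod (reg 0) row_size"

text \<open>Choosing between \<open>RSub\<close> and \<open>RAdd\<close> by a parity avoids a
  multiplication by the sign, and all tests concern naturals only.\<close>

definition sum_step :: com where
  "sum_step = (let a = NDiv (reg 1) (NMem (NLit 1)); b = NMod (reg 1) (NMem (NLit 1));
      pa = NMem (pow_addr (NAdd (NMem (NLit 1)) a)); pb = NMem (pow_addr b);
      term = RMul (RMem (coef_addr (reg 1) (gate_field 1 (reg 2))))
        (RMem (cell_addr (NAdd (NMul (reg 3) row_size) (NSub (NSub cur_mask pa) pb))));
      acc = RMem (cell_addr (reg 0))
    in Cond (NMul (NMod (NDiv cur_mask pa) (NLit 2)) (NMod (NDiv cur_mask pb) (NLit 2)))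
        (Cond (NMod (NAdd
            (NMem (pop_addr (NMod (NDiv cur_mask (NMem (pow_addr (NMem (NLit 1))))) (NMem (pow_addr a)))))
            (NMem (pop_addr (NMod cur_mask pb)))) (NLit 2))
          (RStore (cell_addr (reg 0)) (RSub acc term))
          (RStore (cell_addr (reg 0)) (RAdd acc term)))
        Skip)"

definition mul_gate :: com where
  "mul_gate = Cond (gate_field 0 (reg 2))
     (RStore (cell_addr (reg 0)) (RMul (RMem (scalar_addr (reg 2)))
       (RMem (cell_addr (NAdd (NMul (reg 3) row_size) cur_mask)))))
     (for_loop (reg_addr 1) (NLit 0) (NMul (NMem (NLit 1)) (NMem (NLit 1))) sum_step)"

text \<open>Truncated differences serve as comparisons: the outer one is nonzero only for products,
  the inner one only if the first operand is not an input, in which case skewness makes the second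
  operand one.\<close>

definition select_operands :: com where
  "select_operands = Cond (NSub (gate_field 0 cur_gate) (NLit 2))
     (Cond (NSub (gate_field 0 (gate_field 1 cur_gate)) (NLit 1))
       (Seq (NStore (reg_addr 2) (gate_field 2 cur_gate))
         (NStore (reg_addr 3) (NAdd (gate_field 1 cur_gate) (NLit 1))))
       (Seq (NStore (reg_addr 2) (gate_field 1 cur_gate))
         (NStore (reg_addr 3) (NAdd (gate_field 2 cur_gate) (NLit 1)))))
     (Seq (NStore (reg_addr 2) cur_gate) (NStore (reg_addr 3) (NLit 0)))"

definition add_gate :: com where
  "add_gate = (let arg = (\<lambda>j. RMem (cell_addr
        (NAdd (NMul (NAdd (gate_field j cur_gate) (NLit 1)) row_size) cur_mask)))
    in RStore (cell_addr (reg 0)) (RAdd (arg 1) (arg 2)))"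

text \<open>The sum of the two truncated differences vanishes exactly for addition gates (type 2).\<close>

definition table_step :: com where
  "table_step = Cond (NAdd (NSub (gate_field 0 cur_gate) (NLit 2)) (NSub (NLit 2) (gate_field 0 cur_gate)))
     (Seq select_operands mul_gate) add_gate"

definition main_table :: com where
  "main_table = for_loop (reg_addr 0) row_size (NMul (NAdd (NMem (NLit 2)) (NLit 1)) row_size) table_step"

text \<open>Row 0 takes a single write, as its other cells are 0 from the start. The answer sits in
  the row of the last gate at the mask \<open>4 ^ d - 1\<close>, whose \<open>2 d\<close> bits are
  all set.\<close>

definition program :: com where
  "program = Seq pow_table (Seq pop_table (Seq (RStore (cell_addr (NLit 0)) (RLit 1)) (Seq main_table
     (RStore (NLit 0) (RMem (cell_addr
       (NAdd (NMul (NMem (NLit 2)) row_size) (NSub row_size (NLit 1)))))))))"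

text \<open>Polynomials and circuits are abstracted away; only the recurrences are kept.
  \<open>V r p\<close> is the intended content of row \<open>r\<close> at mask \<open>p\<close>,
  while \<open>gsel\<close> and \<open>rsel\<close> give the input gate and the row that
  \<open>select_operands\<close> has to find.\<close>

locale table_spec =
  fixes n d c :: nat and ty op1 op2 :: "nat \<Rightarrow> nat" and coef :: "nat \<Rightarrow> nat \<Rightarrow> real"
    and scal :: "nat \<Rightarrow> real" and V :: "nat \<Rightarrow> nat \<Rightarrow> real" and gsel rsel :: "nat \<Rightarrow> nat"
  assumes V_0: "p < 4 ^ d \<Longrightarrow> V 0 p = (if p = 0 then 1 else 0)"
    and V_add: "t < c \<Longrightarrow> ty t = 2 \<Longrightarrow> p < 4 ^ d \<Longrightarrow>
      V (Suc t) p = V (Suc (op1 t)) p + V (Suc (op2 t)) p"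
    and ops_less: "t < c \<Longrightarrow> ty t \<ge> 2 \<Longrightarrow> op1 t < t \<and> op2 t < t"
    and gsel: "t < c \<Longrightarrow> gsel t = (if ty t > 2 then if ty (op1 t) > 1 then op2 t else op1 t else t)"
    and rsel: "t < c \<Longrightarrow> rsel t = (if ty t > 2 then if ty (op1 t) > 1 then Suc (op1 t) else Suc (op2 t) else 0)"
    and V_scalar: "t < c \<Longrightarrow> ty t \<noteq> 2 \<Longrightarrow> ty (gsel t) \<noteq> 0 \<Longrightarrow> p < 4 ^ d \<Longrightarrow>
      V (Suc t) p = scal (gsel t) * V (rsel t) p"
    and V_var: "t < c \<Longrightarrow> ty t \<noteq> 2 \<Longrightarrow> ty (gsel t) = 0 \<Longrightarrow> p < 4 ^ d \<Longrightarrow>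
      op1 (gsel t) < n \<and>
      V (Suc t) p = (\<Sum>e<d * d. if bit p (d + e div d) \<and> bit p (e mod d) then
        (- 1) ^ (popcount (p div 2 ^ d mod 2 ^ (e div d)) + popcount (p mod 2 ^ (e mod d))) *
        (coef e (op1 (gsel t)) * V (rsel t) (p - 2 ^ (d + e div d) - 2 ^ (e mod d))) else 0)"
begin

section \<open>Memory invariants and verification of the program\<close>

definition N where "N = 3 + 3 * c"
definition B where "B = d * d * n + c"

definition nat_ok :: "(nat \<Rightarrow> nat) \<Rightarrow> bool" where
  "nat_ok \<nu> \<longleftrightarrow> \<nu> 0 = n \<and> \<nu> 1 = d \<and> \<nu> 2 = c \<and>
    (\<forall>t<c. \<nu> (3 + 3 * t) = ty t \<and> \<nu> (4 + 3 * t) = op1 t \<and> \<nu> (5 + 3 * t) = op2 t)"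

definition pow_ok :: "nat \<Rightarrow> (nat \<Rightarrow> nat) \<Rightarrow> bool" where
  "pow_ok j \<nu> \<longleftrightarrow> (\<forall>k\<le>j. \<nu> (N + (4 + k)) = 2 ^ k)"

definition pop_ok :: "nat \<Rightarrow> (nat \<Rightarrow> nat) \<Rightarrow> bool" where
  "pop_ok j \<nu> \<longleftrightarrow> (\<forall>m<2 ^ d. \<nu> (N + (5 + (2 * d + m))) = (if m < j then popcount m else 0))"

definition real_ok :: "(nat \<Rightarrow> real) \<Rightarrow> bool" where
  "real_ok \<rho> \<longleftrightarrow> (\<forall>e<d * d. \<forall>k<n. \<rho> (e * n + k) = coef e k) \<and> (\<forall>t<c. \<rho> (d * d * n + t) = scal t)"

text \<open>The cells before \<open>q\<close> are final, cell \<open>q\<close> holds the accumulator \<open>v\<close>, and the later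
  ones are untouched.\<close>

definition cells_ok :: "nat \<Rightarrow> real \<Rightarrow> (nat \<Rightarrow> real) \<Rightarrow> bool" where
  "cells_ok q v \<rho> \<longleftrightarrow> (\<forall>x<(c + 1) * 4 ^ d. \<rho> (B + x) =
     (if x < q then V (x div 4 ^ d) (x mod 4 ^ d) else if x = q then v else 0))"

lemma nat_ok_upd: "nat_ok \<nu> \<Longrightarrow> N \<le> a \<Longrightarrow> nat_ok (\<nu>(a := v))"
  unfolding nat_ok_def N_def by auto

lemma pow_ok_upd: "pow_ok j \<nu> \<Longrightarrow> a < N + 4 \<or> N + 4 + j < a \<Longrightarrow> pow_ok j (\<nu>(a := v))"
  unfolding pow_ok_def by auto

lemma pop_ok_upd: "pop_ok j \<nu> \<Longrightarrow> a < N + 5 + 2 * d \<Longrightarrow> pop_ok j (\<nu>(a := v))"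
  unfolding pop_ok_def by auto

lemma real_ok_upd:
  assumes "real_ok \<rho>" "B \<le> a"
  shows "real_ok (\<rho>(a := v))"
proof -
  have "e * n + k < d * d * n" if "e < d * d" "k < n" for e k
  proof -
    have "e * n + k < Suc e * n" using that by simp
    also have "\<dots> \<le> d * d * n" using that by (intro mult_le_mono1) simp
    finally show ?thesis .
  qed
  then have "e * n + k < a" if "e < d * d" "k < n" for e k
    using that assms(2) by (fastforce simp: B_def)
  then show ?thesis using assms unfolding real_ok_def B_def by (auto dest: less_imp_neq)
qed

lemma cells_ok_upd: "cells_ok q v \<rho> \<Longrightarrow> cells_ok q w (\<rho>(B + q := w))"
  unfolding cells_ok_def by auto

text \<open>An untouched cell is 0, so it is ready to serve as an empty sum when its turn
  comes.\<close>

lemma cells_ok_Suc: "cells_ok q v \<rho> \<Longrightarrow> v = V (q div 4 ^ d) (q mod 4 ^ d) \<Longrightarrow> cells_ok (Suc q) 0 \<rho>"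
  unfolding cells_ok_def by (auto simp: less_Suc_eq)

lemma cells_ok_cur: "cells_ok q v \<rho> \<Longrightarrow> q < (c + 1) * 4 ^ d \<Longrightarrow> \<rho> (B + q) = v"
  unfolding cells_ok_def by auto

text \<open>A row before that of \<open>q\<close> lies entirely before \<open>q\<close>. Allowing
  \<open>q\<close> to be the end of the table covers the final read.\<close>

lemma cells_ok_row:
  assumes "cells_ok q v \<rho>" "r < q div 4 ^ d" "p < 4 ^ d" "q \<le> (c + 1) * 4 ^ d"
  shows "\<rho> (B + (r * 4 ^ d + p)) = V r p"
proof -
  have "r * 4 ^ d + p < Suc r * 4 ^ d" using assms(3) by simp
  also have "\<dots> \<le> q div 4 ^ d * 4 ^ d" using assms(2) by (intro mult_le_mono1) simp
  also have "\<dots> \<le> q" by simp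
  finally have "r * 4 ^ d + p < q" .
  then show ?thesis using assms unfolding cells_ok_def by auto
qed

lemma nval_reg_addr: "nat_ok (fst s) \<Longrightarrow> nval (reg_addr k) s = N + k"
  by (simp add: reg_addr_def base_addr_def nat_ok_def N_def)

lemma nval_d: "nat_ok (fst s) \<Longrightarrow> nval (NMem (NLit 1)) s = d"
  and nval_c: "nat_ok (fst s) \<Longrightarrow> nval (NMem (NLit 2)) s = c"
  by (simp_all add: nat_ok_def)

lemma nval_pow_addr: "nat_ok (fst s) \<Longrightarrow> nval (pow_addr e) s = N + (4 + nval e s)"
  by (simp add: pow_addr_def base_addr_def nat_ok_def N_def)

lemma nval_pow:
  "nat_ok (fst s) \<Longrightarrow> pow_ok j (fst s) \<Longrightarrow> nval e s \<le> j \<Longrightarrow> nval (NMem (pow_addr e)) s = 2 ^ nval e s"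
  by (simp add: nval_pow_addr pow_ok_def)

lemma nval_pop_addr: "nat_ok (fst s) \<Longrightarrow> nval (pop_addr e) s = N + (5 + (2 * d + nval e s))"
  by (simp add: pop_addr_def base_addr_def nat_ok_def N_def)

lemma nval_pop:
  "nat_ok (fst s) \<Longrightarrow> pop_ok (2 ^ d) (fst s) \<Longrightarrow> nval e s < 2 ^ d \<Longrightarrow>
    nval (NMem (pop_addr e)) s = popcount (nval e s)"
  by (simp add: nval_pop_addr pop_ok_def)

lemma nval_row_size: "nat_ok (fst s) \<Longrightarrow> pow_ok (2 * d) (fst s) \<Longrightarrow> nval row_size s = 4 ^ d"
  unfolding row_size_def by (subst nval_pow[where j = "2 * d"]) (simp_all add: nat_ok_def power_mult)

lemma nval_coef_addr: "nat_ok (fst s) \<Longrightarrow> nval (coef_addr e i) s = nval e s * n + nval i s"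
  by (simp add: coef_addr_def nat_ok_def)

lemma nval_scalar_addr: "nat_ok (fst s) \<Longrightarrow> nval (scalar_addr t) s = d * d * n + nval t s"
  by (simp add: scalar_addr_def nval_coef_addr) (simp add: nat_ok_def)

lemma nval_cell_addr: "nat_ok (fst s) \<Longrightarrow> nval (cell_addr x) s = B + nval x s"
  by (simp add: cell_addr_def nval_scalar_addr B_def) (simp add: nat_ok_def)

lemma nval_gate_field:
  assumes "nat_ok (fst s)" "nval t s < c"
  shows "nval (gate_field 0 t) s = ty (nval t s)"
    "nval (gate_field 1 t) s = op1 (nval t s)"
    "nval (gate_field 2 t) s = op2 (nval t s)"
  using assms by (auto simp: gate_field_def nat_ok_def numeral_eq_Suc)

definition table_inv :: "nat \<Rightarrow> real \<Rightarrow> state \<Rightarrow> bool" where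
  "table_inv q v s \<longleftrightarrow> nat_ok (fst s) \<and> pow_ok (2 * d) (fst s) \<and> pop_ok (2 ^ d) (fst s) \<and>
     fst s N = q \<and> real_ok (snd s) \<and> cells_ok q v (snd s)"

lemma table_invD:
  assumes "table_inv q v s"
  shows "nat_ok (fst s)" "pow_ok (2 * d) (fst s)" "pop_ok (2 ^ d) (fst s)" "fst s N = q"
    "real_ok (snd s)" "cells_ok q v (snd s)"
  using assms by (simp_all add: table_inv_def)

text \<open>Register 0 is excluded because it holds \<open>q\<close>; offsets below 4 stay clear of
  both tables of naturals.\<close>

lemma table_inv_reg:
  assumes "table_inv q v s" "0 < k" "k < 4"
  shows "table_inv q v ((fst s)(N + k := x), snd s)"
  using assms by (auto simp: table_inv_def nat_ok_upd pow_ok_upd pop_ok_upd)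

lemma table_inv_cell:
  assumes "table_inv q v s"
  shows "table_inv q w (fst s, (snd s)(B + q := w))"
  using assms by (auto simp: table_inv_def real_ok_upd intro: cells_ok_upd)

lemma table_inv_reg_0:
  assumes "table_inv q v s"
  shows "nval (reg 0) s = q"
  using table_invD[OF assms] by (simp add: nval_reg_addr)

lemma table_inv_cur:
  assumes "table_inv q v s"
  shows "nval cur_gate s = q div 4 ^ d - 1" "nval cur_mask s = q mod 4 ^ d"
    "nval row_size s = 4 ^ d"
  using table_invD[OF assms] table_inv_reg_0[OF assms]
  by (simp_all add: cur_gate_def cur_mask_def nval_row_size)

lemma runs_add_gate:
  assumes inv: "table_inv q 0 s" and q: "4 ^ d \<le> q" "q < (c + 1) * 4 ^ d"
    and ty: "ty (q div 4 ^ d - 1) = 2"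
  shows "runs add_gate s 1 (table_inv q (V (q div 4 ^ d) (q mod 4 ^ d)))"
proof -
  note I = table_invD[OF inv] table_inv_reg_0[OF inv] table_inv_cur[OF inv]
  define t where "t = q div 4 ^ d - 1"
  have "1 \<le> q div 4 ^ d" "q div 4 ^ d < c + 1"
    using q by (simp_all add: less_mult_imp_div_less div_greater_zero_iff Suc_le_eq)
  then have t: "q div 4 ^ d = Suc t" "t < c" by (simp_all add: t_def)
  have p: "q mod 4 ^ d < 4 ^ d" by simp
  note a = V_add[OF t(2) ty[folded t_def] p] ops_less[OF t(2)] ty[folded t_def]
  have "nval (gate_field 1 cur_gate) s = op1 t" "nval (gate_field 2 cur_gate) s = op2 t"
    using nval_gate_field[of s cur_gate] I t by simp_all
  then have "rval (RAdd
      (RMem (cell_addr (NAdd (NMul (NAdd (gate_field 1 cur_gate) (NLit 1)) row_size) cur_mask)))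
      (RMem (cell_addr (NAdd (NMul (NAdd (gate_field 2 cur_gate) (NLit 1)) row_size) cur_mask)))) s =
      V (Suc t) (q mod 4 ^ d)"
    using I a t q cells_ok_row[of q 0 "snd s" "Suc (op1 t)" "q mod 4 ^ d"]
      cells_ok_row[of q 0 "snd s" "Suc (op2 t)" "q mod 4 ^ d"]
    by (simp add: nval_cell_addr)
  then show ?thesis
    unfolding add_gate_def Let_def
    by (intro runs_RStore)
      (use table_inv_cell[OF inv] I t in \<open>simp_all add: nval_cell_addr\<close>)
qed

lemma runs_select_operands:
  assumes inv: "table_inv q 0 s" and q: "4 ^ d \<le> q" "q < (c + 1) * 4 ^ d"
  defines "t \<equiv> q div 4 ^ d - 1"
  shows "runs select_operands s 0
    (\<lambda>s. table_inv q 0 s \<and> fst s (N + 2) = gsel t \<and> fst s (N + 3) = rsel t)"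
proof -
  have "1 \<le> q div 4 ^ d" "q div 4 ^ d < c + 1"
    using q by (simp_all add: less_mult_imp_div_less div_greater_zero_iff Suc_le_eq)
  then have t: "q div 4 ^ d = Suc t" "t < c" by (simp_all add: t_def)
  have cur: "nval cur_gate s = t" if "table_inv q 0 s" for s
    using table_inv_cur[OF that] by (simp add: t_def)
  have field: "nval (gate_field 0 cur_gate) s = ty t" "nval (gate_field 1 cur_gate) s = op1 t"
     "nval (gate_field 2 cur_gate) s = op2 t" if "table_inv q 0 s" for s
    using nval_gate_field[of s cur_gate] table_invD(1)[OF that] cur[OF that] t by simp_all
  have field2: "nval (gate_field 0 (gate_field 1 cur_gate)) s = ty (op1 t)"
    if "table_inv q 0 s" "ty t > 2" for s
    using nval_gate_field[of s "gate_field 1 cur_gate"] table_invD(1)[OF that(1)] field[OF that(1)] t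
      ops_less[OF t(2)] that(2) by simp
  \<comment> \<open>The second store is evaluated after register 2 has changed, so the value of
    \<open>y\<close> must be known in every state that satisfies the invariant.\<close>
  have store: "runs (Seq (NStore (reg_addr 2) x) (NStore (reg_addr 3) y)) s 0
      (\<lambda>s. table_inv q 0 s \<and> fst s (N + 2) = gsel t \<and> fst s (N + 3) = rsel t)"
    if "nval x s = gsel t" "\<And>s. table_inv q 0 s \<Longrightarrow> nval y s = rsel t" for x y
  proof (intro runs_Seq_0 runs_NStore)
    let ?s = "((fst s)(nval (reg_addr 2) s := nval x s), snd s)"
    have s: "?s = ((fst s)(N + 2 := gsel t), snd s)"
      using table_invD(1)[OF inv] that(1) by (simp add: nval_reg_addr)
    have inv': "table_inv q 0 ?s" unfolding s by (rule table_inv_reg[OF inv]) simp_all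
    let ?s' = "((fst ?s)(nval (reg_addr 3) ?s := nval y ?s), snd ?s)"
    have s': "?s' = ((fst ?s)(N + 3 := rsel t), snd ?s)"
      using table_invD(1)[OF inv'] that(2)[OF inv'] by (simp add: nval_reg_addr)
    have "table_inv q 0 ?s'" unfolding s' by (rule table_inv_reg[OF inv']) simp_all
    moreover have "fst ?s' (N + 2) = gsel t \<and> fst ?s' (N + 3) = rsel t"
      unfolding s' unfolding s by simp
    ultimately show "table_inv q 0 ?s' \<and> fst ?s' (N + 2) = gsel t \<and> fst ?s' (N + 3) = rsel t"
      by simp
  qed
  show ?thesis
    unfolding select_operands_def
  proof (intro runs_Cond store)
  qed (use inv cur field field2 gsel[OF t(2)] rsel[OF t(2)] in auto)
qed

lemma minus_power_less:
  "p < 4 ^ d \<Longrightarrow> p - x - y < 4 ^ d" for p :: nat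
  by simp

text \<open>The summand of \<open>V_var\<close>, named so that a loop invariant can speak of partial
  sums.\<close>

definition term_at :: "nat \<Rightarrow> nat \<Rightarrow> nat \<Rightarrow> nat \<Rightarrow> real" where
  "term_at g r p e = (if bit p (d + e div d) \<and> bit p (e mod d) then
        (- 1) ^ (popcount (p div 2 ^ d mod 2 ^ (e div d)) + popcount (p mod 2 ^ (e mod d))) *
        (coef e (op1 g) * V r (p - 2 ^ (d + e div d) - 2 ^ (e mod d))) else 0)"

text \<open>The two operations are the product of a coefficient with an earlier cell and its
  addition or subtraction. That the naturals stay fixed preserves the registers of the enclosing
  loop.\<close>

lemma runs_sum_step:
  assumes inv: "table_inv q v s" and q: "4 ^ d \<le> q" "q < (c + 1) * 4 ^ d"
    and e: "fst s (N + 1) = e" "e < d * d" and g: "fst s (N + 2) = g" "op1 g < n" "g < c"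
    and r: "fst s (N + 3) = r" "r < q div 4 ^ d"
  shows "runs sum_step s 2 (\<lambda>s'. fst s' = fst s \<and> table_inv q (v + term_at g r (q mod 4 ^ d) e) s')"
proof -
  note I = table_invD[OF inv] table_inv_reg_0[OF inv] table_inv_cur[OF inv]
  define p where "p = q mod 4 ^ d"
  have p: "p < 4 ^ d" by (simp add: p_def)
  have d: "0 < d" using e by (cases d) auto
  have ab: "e div d < d" "e mod d < d" using e d by (simp_all add: less_mult_imp_div_less)
  then have ab': "e div d \<le> 2 * d" "e mod d \<le> 2 * d" by linarith+
  let ?a = "NDiv (reg 1) (NMem (NLit 1))" and ?b = "NMod (reg 1) (NMem (NLit 1))"
  let ?pa = "NMem (pow_addr (NAdd (NMem (NLit 1)) ?a))" and ?pb = "NMem (pow_addr ?b)"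
  have a: "nval ?a s = e div d" and b: "nval ?b s = e mod d"
    using nval_d[OF I(1)] nval_reg_addr[OF I(1)] e by simp_all
  have pa: "nval ?pa s = 2 ^ (d + e div d)"
    using nval_pow[OF I(1,2), of "NAdd (NMem (NLit 1)) ?a"] a nval_d[OF I(1)] ab by simp
  have pb: "nval ?pb s = 2 ^ (e mod d)"
    using nval_pow[OF I(1,2), of ?b] b ab' by simp
  have pa': "nval (NMem (pow_addr ?a)) s = 2 ^ (e div d)"
    using nval_pow[OF I(1,2), of ?a] a ab' by simp
  have pd: "nval (NMem (pow_addr (NMem (NLit 1)))) s = 2 ^ d"
    using nval_pow[OF I(1,2), of "NMem (NLit 1)"] nval_d[OF I(1)] by simp
  have m: "nval cur_mask s = p" using I by (simp add: p_def)
  let ?i = "NMod (NDiv cur_mask (NMem (pow_addr (NMem (NLit 1))))) (NMem (pow_addr ?a))"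
  let ?j = "NMod cur_mask ?pb"
  \<comment> \<open>Keeps both arguments of the bit count inside its table, which ends at
    \<open>2 ^ d\<close>.\<close>
  have pow_less: "x mod 2 ^ k < 2 ^ d" if "k < d" for x k :: nat
    using that by (meson less_trans mod_less_divisor pos2 power_strict_increasing zero_less_power one_less_numeral_iff semiring_norm(76))
  have i: "nval ?i s = p div 2 ^ d mod 2 ^ (e div d)" using m pd pa' by simp
  have j: "nval ?j s = p mod 2 ^ (e mod d)" using m pb by simp
  have pi: "nval (NMem (pop_addr ?i)) s = popcount (p div 2 ^ d mod 2 ^ (e div d))"
    using nval_pop[OF I(1,3), of ?i] i pow_less ab by simp
  have pj: "nval (NMem (pop_addr ?j)) s = popcount (p mod 2 ^ (e mod d))"
    using nval_pop[OF I(1,3), of ?j] j pow_less ab by simp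
  let ?acc = "RMem (cell_addr (reg 0))"
  let ?t = "RMul (RMem (coef_addr (reg 1) (gate_field 1 (reg 2))))
        (RMem (cell_addr (NAdd (NMul (reg 3) row_size) (NSub (NSub cur_mask ?pa) ?pb))))"
  have acc: "rval ?acc s = v" using I cells_ok_cur[OF I(6)] q by (simp add: nval_cell_addr)
  have "nval (reg 2) s = g" "nval (reg 1) s = e" "nval (reg 3) s = r"
    using nval_reg_addr[OF I(1)] g e r by simp_all
  moreover from this have "nval (gate_field 1 (reg 2)) s = op1 g"
    using nval_gate_field(2)[OF I(1), of "reg 2"] g by simp
  moreover have "snd s (e * n + op1 g) = coef e (op1 g)"
    using I(5) e g by (simp add: real_ok_def)
  ultimately have t: "rval ?t s = coef e (op1 g) * V r (p - 2 ^ (d + e div d) - 2 ^ (e mod d))"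
    using m pa pb I(1,10) cells_ok_row[OF I(6) r(2) minus_power_less[OF p] less_imp_le[OF q(2)]]
    by (simp del: nval.simps(2) add: nval_coef_addr nval_cell_addr)
  have bits: "x div 2 ^ k mod 2 \<noteq> 0 \<longleftrightarrow> bit x k" for x k :: nat
    by (simp add: bit_iff_odd odd_iff_mod_2_eq_one)
  have cell: "nval (cell_addr (reg 0)) s = B + q" using I by (simp add: nval_cell_addr)
  have cond: "nval (NMul (NMod (NDiv cur_mask ?pa) (NLit 2)) (NMod (NDiv cur_mask ?pb) (NLit 2))) s \<noteq> 0
      \<longleftrightarrow> bit p (d + e div d) \<and> bit p (e mod d)"
    using bits[of p "d + e div d"] bits[of p "e mod d"] m pa pb by (simp del: nval.simps(2))
  have sign: "nval (NMod (NAdd (NMem (pop_addr ?i)) (NMem (pop_addr ?j))) (NLit 2)) s \<noteq> 0 \<longleftrightarrow>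
      odd (popcount (p div 2 ^ d mod 2 ^ (e div d)) + popcount (p mod 2 ^ (e mod d)))"
    by (simp only: nval.simps(1,3,7) pi pj even_iff_mod_2_eq_zero)
  have sub: "rval (RSub ?acc ?t) s = v + term_at g r p e"
    if "bit p (d + e div d) \<and> bit p (e mod d)"
       "odd (popcount (p div 2 ^ d mod 2 ^ (e div d)) + popcount (p mod 2 ^ (e mod d)))"
    unfolding rval.simps(4) acc t using that by (simp add: term_at_def)
  have add: "rval (RAdd ?acc ?t) s = v + term_at g r p e"
    if "bit p (d + e div d) \<and> bit p (e mod d)"
       "\<not> odd (popcount (p div 2 ^ d mod 2 ^ (e div d)) + popcount (p mod 2 ^ (e mod d)))"
    unfolding rval.simps(3) acc t using that by (simp add: term_at_def)
  have store: "runs (RStore (cell_addr (reg 0)) x) s 2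
      (\<lambda>s'. fst s' = fst s \<and> table_inv q (v + term_at g r p e) s')"
    if "rval x s = v + term_at g r p e" "rops x = 2" for x
    using table_inv_cell[OF inv] that cell by (intro runs_RStore) simp_all
  show ?thesis
    unfolding sum_step_def Let_def p_def[symmetric]
  proof (rule runs_Cond)
    assume nz: "nval (NMul (NMod (NDiv cur_mask ?pa) (NLit 2)) (NMod (NDiv cur_mask ?pb) (NLit 2))) s \<noteq> 0"
    show "runs (Cond (NMod (NAdd (NMem (pop_addr ?i)) (NMem (pop_addr ?j))) (NLit 2))
        (RStore (cell_addr (reg 0)) (RSub ?acc ?t)) (RStore (cell_addr (reg 0)) (RAdd ?acc ?t))) s 2
        (\<lambda>s'. fst s' = fst s \<and> table_inv q (v + term_at g r p e) s')"
    proof (rule runs_Cond)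
      assume "nval (NMod (NAdd (NMem (pop_addr ?i)) (NMem (pop_addr ?j))) (NLit 2)) s \<noteq> 0"
      then show "runs (RStore (cell_addr (reg 0)) (RSub ?acc ?t)) s 2
          (\<lambda>s'. fst s' = fst s \<and> table_inv q (v + term_at g r p e) s')"
        using nz cond sign by (intro store sub) simp_all
    next
      assume "nval (NMod (NAdd (NMem (pop_addr ?i)) (NMem (pop_addr ?j))) (NLit 2)) s = 0"
      then show "runs (RStore (cell_addr (reg 0)) (RAdd ?acc ?t)) s 2
          (\<lambda>s'. fst s' = fst s \<and> table_inv q (v + term_at g r p e) s')"
        using nz cond sign by (intro store add) simp_all
    qed
  next
    assume "nval (NMul (NMod (NDiv cur_mask ?pa) (NLit 2)) (NMod (NDiv cur_mask ?pb) (NLit 2))) s = 0"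
    then show "runs Skip s 2 (\<lambda>s'. fst s' = fst s \<and> table_inv q (v + term_at g r p e) s')"
      using inv cond by (intro runs_Skip) (auto simp: term_at_def)
  qed
qed

lemma gsel_rsel_less:
  assumes "t < c"
  shows "gsel t < c" "rsel t \<le> t"
  using ops_less[OF assms] assms by (auto simp: gsel[OF assms] rsel[OF assms])

text \<open>A scalar factor costs one multiplication, a variable at most two operations for each of
  the \<open>d\<^sup>2\<close> matrix entries; the bound covers either case.\<close>

lemma runs_mul_gate:
  assumes inv: "table_inv q 0 s" and q: "4 ^ d \<le> q" "q < (c + 1) * 4 ^ d"
  defines "t \<equiv> q div 4 ^ d - 1"
  assumes ty: "ty t \<noteq> 2" and g: "fst s (N + 2) = gsel t" and r: "fst s (N + 3) = rsel t"
  shows "runs mul_gate s (2 * d * d + 1) (table_inv q (V (q div 4 ^ d) (q mod 4 ^ d)))"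
proof -
  note I = table_invD[OF inv] table_inv_reg_0[OF inv] table_inv_cur[OF inv]
  have "1 \<le> q div 4 ^ d" "q div 4 ^ d < c + 1"
    using q by (simp_all add: less_mult_imp_div_less div_greater_zero_iff Suc_le_eq)
  then have t: "q div 4 ^ d = Suc t" "t < c" by (simp_all add: t_def)
  note less = gsel_rsel_less[OF t(2)]
  define p where "p = q mod 4 ^ d"
  have p: "p < 4 ^ d" by (simp add: p_def)
  have r_less: "rsel t < q div 4 ^ d" using less t by simp
  have regs: "nval (reg 2) s = gsel t" "nval (reg 3) s = rsel t"
    using nval_reg_addr[OF I(1)] g r by simp_all
  then have tyg: "nval (gate_field 0 (reg 2)) s = ty (gsel t)"
    using nval_gate_field(1)[OF I(1), of "reg 2"] less by simp
  show ?thesis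
    unfolding mul_gate_def
  proof (intro runs_Cond)
    assume nz: "nval (gate_field 0 (reg 2)) s \<noteq> 0"
    have "snd s (d * d * n + gsel t) = scal (gsel t)" using I(5) less by (simp add: real_ok_def)
    then have "rval (RMul (RMem (scalar_addr (reg 2)))
       (RMem (cell_addr (NAdd (NMul (reg 3) row_size) cur_mask)))) s = V (Suc t) p"
      using V_scalar[OF t(2) ty _ p] nz tyg regs I
        cells_ok_row[OF I(6) r_less p less_imp_le[OF q(2)]]
      by (simp del: nval.simps(2) add: nval_cell_addr nval_scalar_addr p_def[symmetric])
    then show "runs (RStore (cell_addr (reg 0)) (RMul (RMem (scalar_addr (reg 2)))
       (RMem (cell_addr (NAdd (NMul (reg 3) row_size) cur_mask))))) s (2 * d * d + 1)
       (table_inv q (V (q div 4 ^ d) (q mod 4 ^ d)))"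
      by (intro runs_RStore) (use table_inv_cell[OF inv] I t in \<open>simp_all add: nval_cell_addr p_def\<close>)
  next
    assume "nval (gate_field 0 (reg 2)) s = 0"
    then have z: "ty (gsel t) = 0" using tyg by simp
    note Vv = V_var[OF t(2) ty z p, folded term_at_def]
    \<comment> \<open>The current cell accumulates the terms of the entries before \<open>e\<close>;
      registers 1 to 3 hold the entry, the input gate and the row of the other factor.\<close>
    define Inv where "Inv e s \<longleftrightarrow> table_inv q (\<Sum>e'<e. term_at (gsel t) (rsel t) p e') s \<and>
      fst s (N + 1) = e \<and> fst s (N + 2) = gsel t \<and> fst s (N + 3) = rsel t" for e s
    have "runs (for_loop (reg_addr 1) (NLit 0) (NMul (NMem (NLit 1)) (NMem (NLit 1))) sum_step) s
        ((d * d - 0) * 2) (table_inv q (V (q div 4 ^ d) (q mod 4 ^ d)))"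
    proof (rule runs_for_loop[where Inv = Inv])
      show "Inv 0 ((fst s)(nval (reg_addr 1) s := nval (NLit 0) s), snd s)"
        using table_inv_reg[OF inv, of 1 0] g r by (simp add: Inv_def nval_reg_addr[OF I(1)])
      show "nval (NMul (NMem (NLit 1)) (NMem (NLit 1))) s = d * d \<and> nval (reg 1) s = i"
        if "Inv i s" for i s
      proof -
        have "nat_ok (fst s)" using that by (simp add: Inv_def table_inv_def)
        then show ?thesis using that nval_d[of s] by (simp add: nval_reg_addr Inv_def)
      qed
      show "table_inv q (V (q div 4 ^ d) (q mod 4 ^ d)) s" if "Inv (d * d) s" for s
        using that Vv by (simp add: Inv_def t flip: p_def)
      show "runs sum_step s 2
        (\<lambda>s'. Inv (Suc e) ((fst s')(nval (reg_addr 1) s' := Suc (nval (reg 1) s')), snd s'))"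
        if e: "e < d * d" and "Inv e s" for e s
      proof (rule runs_mono[OF runs_sum_step])
        show "table_inv q (\<Sum>e'<e. term_at (gsel t) (rsel t) p e') s" "fst s (N + 1) = e"
          "fst s (N + 2) = gsel t" "fst s (N + 3) = rsel t"
          using \<open>Inv e s\<close> by (simp_all add: Inv_def)
        fix s' assume s': "fst s' = fst s \<and> table_inv q ((\<Sum>e'<e. term_at (gsel t) (rsel t) p e') +
          term_at (gsel t) (rsel t) (q mod 4 ^ d) e) s'"
        then have "table_inv q (\<Sum>e'<Suc e. term_at (gsel t) (rsel t) p e') s'" by (simp add: p_def)
        from table_inv_reg[OF this, of 1 "Suc e"] table_invD(1)[OF this]
        show "Inv (Suc e) ((fst s')(nval (reg_addr 1) s' := Suc (nval (reg 1) s')), snd s')"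
          using s' \<open>Inv e s\<close> by (simp add: Inv_def nval_reg_addr)
      qed (use q e less Vv r_less in simp_all)
    qed simp
    then show "runs (for_loop (reg_addr 1) (NLit 0) (NMul (NMem (NLit 1)) (NMem (NLit 1))) sum_step) s
        (2 * d * d + 1) (table_inv q (V (q div 4 ^ d) (q mod 4 ^ d)))"
      by (rule runs_mono) simp_all
  qed
qed

lemma runs_table_step:
  assumes inv: "table_inv q 0 s" and q: "4 ^ d \<le> q" "q < (c + 1) * 4 ^ d"
  shows "runs table_step s (2 * d * d + 1) (table_inv q (V (q div 4 ^ d) (q mod 4 ^ d)))"
proof -
  have "q div 4 ^ d < c + 1" using q by (simp add: less_mult_imp_div_less)
  moreover have "1 \<le> q div 4 ^ d" using q by (simp add: div_greater_zero_iff Suc_le_eq)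
  ultimately have "q div 4 ^ d - 1 < c" by linarith
  then have ty: "nval (gate_field 0 cur_gate) s = ty (q div 4 ^ d - 1)"
    using nval_gate_field(1)[OF table_invD(1)[OF inv], of cur_gate] table_inv_cur[OF inv] by simp
  show ?thesis
    unfolding table_step_def
  proof (intro runs_Cond runs_Seq_0)
    assume "nval (NAdd (NSub (gate_field 0 cur_gate) (NLit 2)) (NSub (NLit 2) (gate_field 0 cur_gate))) s \<noteq> 0"
    then have "ty (q div 4 ^ d - 1) \<noteq> 2" using ty by auto
    note mul = runs_mul_gate[OF _ q this]
    show "runs select_operands s 0 (\<lambda>s'. runs mul_gate s' (2 * d * d + 1)
        (table_inv q (V (q div 4 ^ d) (q mod 4 ^ d))))"
      by (rule runs_mono[OF runs_select_operands[OF inv q] order_refl]) (elim conjE, rule mul)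
  next
    assume "nval (NAdd (NSub (gate_field 0 cur_gate) (NLit 2)) (NSub (NLit 2) (gate_field 0 cur_gate))) s = 0"
    then have "ty (q div 4 ^ d - 1) = 2" using ty by simp
    from runs_add_gate[OF inv q this]
    show "runs add_gate s (2 * d * d + 1) (table_inv q (V (q div 4 ^ d) (q mod 4 ^ d)))"
      by (rule runs_mono) simp_all
  qed
qed

lemma table_inv_next:
  assumes "table_inv q (V (q div 4 ^ d) (q mod 4 ^ d)) s"
  shows "table_inv (Suc q) 0 ((fst s)(N := Suc q), snd s)"
  using assms cells_ok_Suc
  by (auto simp: table_inv_def nat_ok_upd pow_ok_upd pop_ok_upd)

text \<open>The first hypothesis describes the state once the loop header has set register 0. With
  row 0 in place, \<open>c\<close> rows of \<open>4 ^ d\<close> cells remain.\<close>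

lemma runs_main_table:
  assumes "table_inv (4 ^ d) 0 ((fst s)(N := 4 ^ d), snd s)"
    and "nat_ok (fst s)" "pow_ok (2 * d) (fst s)"
  shows "runs main_table s (c * 4 ^ d * (2 * d * d + 1)) (table_inv ((c + 1) * 4 ^ d) 0)"
proof -
  have "runs main_table s (((c + 1) * 4 ^ d - 4 ^ d) * (2 * d * d + 1)) (table_inv ((c + 1) * 4 ^ d) 0)"
    unfolding main_table_def
  proof (rule runs_for_loop[where Inv = "\<lambda>q. table_inv q 0"])
    show "table_inv (4 ^ d) 0 ((fst s)(nval (reg_addr 0) s := nval row_size s), snd s)"
      using assms by (simp add: nval_reg_addr nval_row_size)
    show "nval (NMul (NAdd (NMem (NLit 2)) (NLit 1)) row_size) s = (c + 1) * 4 ^ d \<and> nval (reg 0) s = q"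
      if "table_inv q 0 s" for q s
      using table_inv_cur(3)[OF that] table_inv_reg_0[OF that] nval_c[OF table_invD(1)[OF that]] by simp
    show "runs table_step s (2 * d * d + 1)
        (\<lambda>s'. table_inv (Suc q) 0 ((fst s')(nval (reg_addr 0) s' := Suc (nval (reg 0) s')), snd s'))"
      if "4 ^ d \<le> q" "q < (c + 1) * 4 ^ d" "table_inv q 0 s" for q s
    proof (rule runs_mono[OF runs_table_step[OF that(3,1,2)] order_refl])
      fix s' assume s': "table_inv q (V (q div 4 ^ d) (q mod 4 ^ d)) s'"
      then show "table_inv (Suc q) 0 ((fst s')(nval (reg_addr 0) s' := Suc (nval (reg 0) s')), snd s')"
        using table_inv_next[OF s'] table_invD[OF s'] by (simp add: nval_reg_addr)
    qed
  qed simp_all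
  then show ?thesis by (rule runs_mono) simp_all
qed

lemma runs_pow_table:
  assumes "nat_ok (fst s)" "\<And>x. N \<le> x \<Longrightarrow> fst s x = 0"
  shows "runs pow_table s 0
    (\<lambda>s'. nat_ok (fst s') \<and> pow_ok (2 * d) (fst s') \<and> pop_ok 0 (fst s') \<and> snd s' = snd s)"
  unfolding pow_table_def
proof (intro runs_Seq_0 runs_NStore)
  define Inv where "Inv i s' \<longleftrightarrow> nat_ok (fst s') \<and> fst s' N = i \<and> pow_ok i (fst s') \<and>
    pop_ok 0 (fst s') \<and> snd s' = snd s" for i s'
  let ?s = "((fst s)(nval (pow_addr (NLit 0)) s := nval (NLit 1) s), snd s)"
  have s: "?s = ((fst s)(N + 4 := 1), snd s)" using assms by (simp add: nval_pow_addr)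
  have ok: "nat_ok (fst ?s)" unfolding s using assms by (simp add: nat_ok_upd)
  have "runs (for_loop (reg_addr 0) (NLit 0) (NMul (NLit 2) (NMem (NLit 1)))
       (NStore (pow_addr (NAdd (reg 0) (NLit 1))) (NMul (NLit 2) (NMem (pow_addr (reg 0)))))) ?s
       ((2 * d - 0) * 0) (Inv (2 * d))"
  proof (rule runs_for_loop[where Inv = Inv])
    have "pop_ok 0 (fst s)" using assms(2) by (simp add: pop_ok_def)
    then show "Inv 0 ((fst ?s)(nval (reg_addr 0) ?s := nval (NLit 0) ?s), snd ?s)"
      using assms unfolding nval_reg_addr[OF ok] unfolding s
      by (simp add: Inv_def nat_ok_upd pop_ok_upd) (simp add: pow_ok_def)
    show "nval (NMul (NLit 2) (NMem (NLit 1))) s = 2 * d \<and> nval (reg 0) s = i" if "Inv i s" for i s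
    proof -
      have "nat_ok (fst s)" using that by (simp add: Inv_def)
      then show ?thesis using that nval_d[of s] by (simp add: nval_reg_addr Inv_def)
    qed
    fix i s' assume i: "i < 2 * d" and inv: "Inv i s'"
    let ?e = "NMul (NLit 2) (NMem (pow_addr (reg 0)))"
    have ok': "nat_ok (fst s')" "pow_ok i (fst s')" using inv by (simp_all add: Inv_def)
    have r: "nval (reg 0) s' = i" using inv ok' by (simp add: nval_reg_addr Inv_def)
    have e: "nval ?e s' = 2 ^ Suc i" using nval_pow[OF ok', of "reg 0"] r by simp
    have a: "nval (pow_addr (NAdd (reg 0) (NLit 1))) s' = N + (4 + Suc i)"
      using r by (simp add: nval_pow_addr[OF ok'(1)])
    let ?f = "(fst s')(N + (4 + Suc i) := 2 ^ Suc i)"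
    have "nat_ok ?f" using ok'(1) by (rule nat_ok_upd) simp
    moreover have "pow_ok (Suc i) ?f" using ok'(2) by (auto simp: pow_ok_def le_Suc_eq)
    moreover have "pop_ok 0 ?f" using inv i by (intro pop_ok_upd) (auto simp: Inv_def)
    moreover have "?f N = i" using inv by (simp add: Inv_def)
    ultimately show "runs (NStore (pow_addr (NAdd (reg 0) (NLit 1))) ?e) s' 0
        (\<lambda>s'. Inv (Suc i) ((fst s')(nval (reg_addr 0) s' := Suc (nval (reg 0) s')), snd s'))"
      using inv by (intro runs_NStore, unfold a e)
        (simp add: Inv_def nval_reg_addr nat_ok_upd pow_ok_upd pop_ok_upd)
  qed simp_all
  then show "runs (for_loop (reg_addr 0) (NLit 0) (NMul (NLit 2) (NMem (NLit 1)))
       (NStore (pow_addr (NAdd (reg 0) (NLit 1))) (NMul (NLit 2) (NMem (pow_addr (reg 0)))))) ?s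
       0 (\<lambda>s'. nat_ok (fst s') \<and> pow_ok (2 * d) (fst s') \<and> pop_ok 0 (fst s') \<and> snd s' = snd s)"
    by (rule runs_mono) (simp_all add: Inv_def)
qed

lemma runs_pop_table:
  assumes "nat_ok (fst s)" "pow_ok (2 * d) (fst s)" "pop_ok 0 (fst s)"
  shows "runs pop_table s 0
    (\<lambda>s'. nat_ok (fst s') \<and> pow_ok (2 * d) (fst s') \<and> pop_ok (2 ^ d) (fst s') \<and> snd s' = snd s)"
proof -
  define Inv where "Inv i s' \<longleftrightarrow> nat_ok (fst s') \<and> fst s' N = i \<and> pow_ok (2 * d) (fst s') \<and>
    pop_ok i (fst s') \<and> snd s' = snd s" for i s'
  have "runs pop_table s ((2 ^ d - 0) * 0) (Inv (2 ^ d))"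
    unfolding pop_table_def
  proof (rule runs_for_loop[where Inv = Inv])
    show "Inv 0 ((fst s)(nval (reg_addr 0) s := nval (NLit 0) s), snd s)"
      using assms by (simp add: Inv_def nval_reg_addr nat_ok_upd pow_ok_upd pop_ok_upd)
    show "nval (NMem (pow_addr (NMem (NLit 1)))) s = 2 ^ d \<and> nval (reg 0) s = i" if "Inv i s" for i s
    proof -
      have "nat_ok (fst s)" "pow_ok (2 * d) (fst s)" using that by (simp_all add: Inv_def)
      then show ?thesis
        using that nval_d[of s] nval_pow[of s "2 * d" "NMem (NLit 1)"] by (simp add: nval_reg_addr Inv_def)
    qed
    fix i s' assume i: "i < 2 ^ d" and inv: "Inv i s'"
    let ?e = "NAdd (NMod (reg 0) (NLit 2)) (NMem (pop_addr (NDiv (reg 0) (NLit 2))))"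
    have ok: "nat_ok (fst s')" "pow_ok (2 * d) (fst s')" "pop_ok i (fst s')"
      using inv by (simp_all add: Inv_def)
    have r: "nval (reg 0) s' = i" using inv ok by (simp add: nval_reg_addr Inv_def)
    have "i div 2 < 2 ^ d" using i by (meson div_le_dividend le_less_trans)
    \<comment> \<open>Entry \<open>i div 2\<close> is already filled unless \<open>i = 0\<close>. In
      that case the cell read is the one about to be written, and its initial 0 is the right
      value.\<close>
    then have "nval (NMem (pop_addr (NDiv (reg 0) (NLit 2)))) s' =
        (if i div 2 < i then popcount (i div 2) else 0)"
      using r ok by (simp add: nval_pop_addr pop_ok_def)
    then have e: "nval ?e s' = popcount i"
      using r by (cases "i = 0") (simp_all add: popcount.simps[of i] popcount.simps[of 0])
    have a: "nval (pop_addr (reg 0)) s' = N + (5 + (2 * d + i))"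
      using r by (simp add: nval_pop_addr[OF ok(1)])
    let ?f = "(fst s')(N + (5 + (2 * d + i)) := popcount i)"
    have "nat_ok ?f" using ok(1) by (rule nat_ok_upd) simp
    moreover have "pow_ok (2 * d) ?f" using ok(2) by (rule pow_ok_upd) simp
    moreover have "pop_ok (Suc i) ?f" using ok(3) by (auto simp: pop_ok_def less_Suc_eq)
    moreover have "?f N = i" using inv by (simp add: Inv_def)
    ultimately show "runs (NStore (pop_addr (reg 0)) ?e) s' 0
        (\<lambda>s'. Inv (Suc i) ((fst s')(nval (reg_addr 0) s' := Suc (nval (reg 0) s')), snd s'))"
      using inv by (intro runs_NStore, unfold a e)
        (simp add: Inv_def nval_reg_addr nat_ok_upd pow_ok_upd pop_ok_upd)
  qed simp_all
  then show ?thesis by (rule runs_mono) (simp_all add: Inv_def)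
qed

lemma runs_program:
  assumes "nat_ok (fst s)" "\<And>x. N \<le> x \<Longrightarrow> fst s x = 0"
    and "real_ok (snd s)" "\<And>x. B \<le> x \<Longrightarrow> snd s x = 0"
  shows "runs program s (c * 4 ^ d * (2 * d * d + 1)) (\<lambda>s'. snd s' 0 = V c (4 ^ d - 1))"
proof -
  have fin: "runs (RStore (NLit 0) (RMem (cell_addr
       (NAdd (NMul (NMem (NLit 2)) row_size) (NSub row_size (NLit 1)))))) s' 0
       (\<lambda>s'. snd s' 0 = V c (4 ^ d - 1))" if "table_inv ((c + 1) * 4 ^ d) 0 s'" for s'
  proof -
    note I = table_invD[OF that] table_inv_cur(3)[OF that]
    have "nval (cell_addr (NAdd (NMul (NMem (NLit 2)) row_size) (NSub row_size (NLit 1)))) s' =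
        B + (c * 4 ^ d + (4 ^ d - 1))"
      using I nval_c[OF I(1)] by (simp add: nval_cell_addr)
    then show ?thesis
      using cells_ok_row[OF I(6), of c "4 ^ d - 1"] by (intro runs_RStore) simp_all
  qed
  \<comment> \<open>One write at \<open>B\<close> completes row 0: by \<open>V_0\<close> its other
    cells are to be 0, which is their initial content.\<close>
  have start: "table_inv (4 ^ d) 0 ((fst s')(N := 4 ^ d), (snd s)(B := 1))"
    if "nat_ok (fst s')" "pow_ok (2 * d) (fst s')" "pop_ok (2 ^ d) (fst s')" for s'
  proof -
    have "cells_ok (4 ^ d) 0 ((snd s)(B := 1))"
      using assms(4) V_0 by (auto simp: cells_ok_def)
    then show ?thesis
      using that assms(3) by (simp add: table_inv_def nat_ok_upd pow_ok_upd pop_ok_upd real_ok_upd)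
  qed
  \<comment> \<open>The summand 0 is the cost of the final copy, split off to fit
    \<open>runs_Seq\<close>.\<close>
  have "runs program s (c * 4 ^ d * (2 * d * d + 1) + 0) (\<lambda>s'. snd s' 0 = V c (4 ^ d - 1))"
    unfolding program_def
  proof (rule runs_Seq_0, rule runs_mono[OF runs_pow_table[OF assms(1,2)]])
    fix s1 assume "nat_ok (fst s1) \<and> pow_ok (2 * d) (fst s1) \<and> pop_ok 0 (fst s1) \<and> snd s1 = snd s"
    then have s1: "nat_ok (fst s1)" "pow_ok (2 * d) (fst s1)" "pop_ok 0 (fst s1)" "snd s1 = snd s"
      by simp_all
    show "runs (Seq pop_table (Seq (RStore (cell_addr (NLit 0)) (RLit 1)) (Seq main_table
     (RStore (NLit 0) (RMem (cell_addr
       (NAdd (NMul (NMem (NLit 2)) row_size) (NSub row_size (NLit 1))))))))) s1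
      (c * 4 ^ d * (2 * d * d + 1) + 0) (\<lambda>s'. snd s' 0 = V c (4 ^ d - 1))"
    proof (rule runs_Seq_0, rule runs_mono[OF runs_pop_table[OF s1(1-3)]])
      fix s2 assume s2: "nat_ok (fst s2) \<and> pow_ok (2 * d) (fst s2) \<and> pop_ok (2 ^ d) (fst s2) \<and>
        snd s2 = snd s1"
      show "runs (Seq (RStore (cell_addr (NLit 0)) (RLit 1)) (Seq main_table
         (RStore (NLit 0) (RMem (cell_addr
         (NAdd (NMul (NMem (NLit 2)) row_size) (NSub row_size (NLit 1)))))))) s2
        (c * 4 ^ d * (2 * d * d + 1) + 0) (\<lambda>s'. snd s' 0 = V c (4 ^ d - 1))"
      proof (rule runs_Seq_0, rule runs_RStore)
        let ?s = "(fst s2, (snd s2)(nval (cell_addr (NLit 0)) s2 := rval (RLit 1) s2))"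
        have s: "?s = (fst s2, (snd s)(B := 1))" using s2 s1 by (simp add: nval_cell_addr)
        show "runs (Seq main_table (RStore (NLit 0) (RMem (cell_addr
           (NAdd (NMul (NMem (NLit 2)) row_size) (NSub row_size (NLit 1))))))) ?s
          (c * 4 ^ d * (2 * d * d + 1) + 0) (\<lambda>s'. snd s' 0 = V c (4 ^ d - 1))"
          unfolding s
          by (rule runs_Seq, rule runs_mono[OF runs_main_table order_refl fin])
            (use start[of s2] s2 in simp_all)
      qed simp_all
    qed simp_all
  qed simp_all
  then show ?thesis by simp
qed

end

section \<open>Correctness on encoded inputs\<close>

lemma gate_polys_snoc: "gate_polys (C @ [G]) = gate_polys C @ [gate_poly (gate_polys C) G]"
  by (simp add: gate_polys_def)

lemma length_gate_polys: "length (gate_polys C) = length C"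
  by (induction C rule: rev_induct) (simp_all add: gate_polys_snoc gate_polys_def)

lemma gate_poly_cong:
  assumes "wf_gate n t G" "\<And>l. l < t \<Longrightarrow> vs ! l = ws ! l"
  shows "gate_poly vs G = gate_poly ws G"
  using assms by (cases G) auto

text \<open>The fold evaluates a gate against the gates before it. Well-formed operands lie in that
  prefix, where the complete list agrees with it.\<close>

lemma gate_polys_nth:
  assumes "\<And>t. t < length C \<Longrightarrow> wf_gate n t (C ! t)" "t < length C"
  shows "gate_polys C ! t = gate_poly (gate_polys C) (C ! t)"
  using assms
proof (induction C arbitrary: t rule: rev_induct)
  case (snoc G C)
  have wf: "wf_gate n t (C ! t)" if "t < length C" for t
    using snoc.prems(1)[of t] that by (simp add: nth_append)
  show ?case
  proof (cases "t < length C")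
    case True
    then have "gate_polys (C @ [G]) ! t = gate_poly (gate_polys C) (C ! t)"
      using snoc.IH[OF wf] by (simp add: gate_polys_snoc nth_append length_gate_polys)
    also have "\<dots> = gate_poly (gate_polys (C @ [G])) (C ! t)"
      by (rule gate_poly_cong[OF wf])
        (use True in \<open>simp_all add: gate_polys_snoc nth_append length_gate_polys\<close>)
    finally show ?thesis using True by (simp add: nth_append)
  next
    case False
    then have t: "t = length C" using snoc.prems(2) by simp
    have "gate_polys (C @ [G]) ! t = gate_poly (gate_polys C) G"
      using t by (simp add: gate_polys_snoc nth_append length_gate_polys)
    also have "\<dots> = gate_poly (gate_polys (C @ [G])) G"
      by (rule gate_poly_cong[of n t])
        (use snoc.prems(1)[of t] t in \<open>simp_all add: gate_polys_snoc nth_append length_gate_polys\<close>)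
    finally show ?thesis using t by (simp add: nth_append)
  qed
qed simp

section \<open>Layout of the encoded input\<close>

lemma nth_concat_uniform:
  assumes "\<And>x. x \<in> set xs \<Longrightarrow> length x = m" "i < length xs" "k < m"
  shows "concat xs ! (i * m + k) = xs ! i ! k"
  using assms
proof (induction xs arbitrary: i)
  case (Cons x xs)
  then show ?case by (cases i) (auto simp: nth_append)
qed simp

lemma length_concat_uniform:
  assumes "\<And>x. x \<in> set xs \<Longrightarrow> length x = m"
  shows "length (concat xs) = length xs * m"
  using assms by (induction xs) auto

lemma index_less_mult: "i < a \<Longrightarrow> k < m \<Longrightarrow> i * m + k < a * (m::nat)"
  by (metis add_less_cancel_left less_le_trans mult_Suc mult_le_mono1 Suc_leI add.commute)

definition gate_type :: "circuit \<Rightarrow> nat \<Rightarrow> nat" where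
  "gate_type C t = gate_code (C ! t) ! 0"

definition gate_op1 :: "circuit \<Rightarrow> nat \<Rightarrow> nat" where
  "gate_op1 C t = gate_code (C ! t) ! 1"

definition gate_op2 :: "circuit \<Rightarrow> nat \<Rightarrow> nat" where
  "gate_op2 C t = gate_code (C ! t) ! 2"

lemma length_gate_code: "length (gate_code G) = 3"
  by (cases G) simp_all

lemma length_nat_input: "length (nat_input n d C) = 3 + 3 * length C"
proof -
  have "length (concat (map gate_code C)) = length (map gate_code C) * 3"
    by (rule length_concat_uniform) (auto simp: length_gate_code)
  then show ?thesis by (simp add: nat_input_def)
qed

lemma memory_nat_input:
  "memory (nat_input n d C) 0 = n" "memory (nat_input n d C) 1 = d"
  "memory (nat_input n d C) 2 = length C"
  by (simp_all add: memory_def length_nat_input) (simp_all add: nat_input_def)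

lemma memory_nat_input_gate:
  assumes "t < length C" "j < 3"
  shows "memory (nat_input n d C) (3 + j + 3 * t) = gate_code (C ! t) ! j"
proof -
  have "concat (map gate_code C) ! (t * 3 + j) = gate_code (C ! t) ! j"
    using assms by (subst nth_concat_uniform) (auto simp: length_gate_code)
  moreover have "3 + j + 3 * t < 3 + 3 * length C" using assms by simp
  moreover have "nat_input n d C ! (3 + j + 3 * t) = concat (map gate_code C) ! (t * 3 + j)"
    using nth_append_length_plus[of "[n, d, length C]" "concat (map gate_code C)" "t * 3 + j"]
    by (simp add: nat_input_def ac_simps)
  ultimately show ?thesis by (simp add: memory_def length_nat_input)
qed

text \<open>One matrix row is split off from the nested concatenation, so that indexing into blocks
  of equal length can be applied at each level.\<close>

definition coef_row :: "nat \<Rightarrow> nat \<Rightarrow> mpoly mat \<Rightarrow> nat \<Rightarrow> real list" where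
  "coef_row n d X i =
     concat (map (\<lambda>j. map (\<lambda>k. lookup (X $$ (i, j)) (single k 1)) [0..<n]) [0..<d])"

definition coef_list :: "nat \<Rightarrow> nat \<Rightarrow> mpoly mat \<Rightarrow> real list" where
  "coef_list n d X = concat (map (coef_row n d X) [0..<d])"

lemma length_coef_row: "length (coef_row n d X i) = d * n"
  unfolding coef_row_def by (subst length_concat_uniform[of _ n]) auto

lemma length_coef_list: "length (coef_list n d X) = d * d * n"
  unfolding coef_list_def by (subst length_concat_uniform[of _ "d * n"]) (auto simp: length_coef_row)

lemma coef_row_nth:
  assumes "j < d" "k < n"
  shows "coef_row n d X i ! (j * n + k) = lookup (X $$ (i, j)) (single k 1)"
  unfolding coef_row_def using assms by (subst nth_concat_uniform[of _ n]) auto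

lemma coef_list_nth:
  assumes "e < d * d" "k < n"
  shows "coef_list n d X ! (e * n + k) = lookup (X $$ (e div d, e mod d)) (single k 1)"
proof -
  have d: "0 < d" using assms by (cases d) auto
  have ab: "e div d < d" "e mod d < d" using assms d by (simp_all add: less_mult_imp_div_less)
  \<comment> \<open>The index is regrouped into a block of length \<open>d * n\<close> for the
    matrix row and an offset inside it.\<close>
  have "(e div d * d + e mod d) * n + k = e div d * (d * n) + (e mod d * n + k)"
    by (simp only: distrib_right mult.assoc add.assoc)
  then have e: "e * n + k = e div d * (d * n) + (e mod d * n + k)" by simp
  show ?thesis
    unfolding e coef_list_def
    using ab assms index_less_mult[of "e mod d" d k n]
    by (subst nth_concat_uniform[of _ "d * n"]) (auto simp: length_coef_row coef_row_nth)
qed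

lemma real_input_eq: "real_input n d C X = coef_list n d X @ map gate_scalar C"
  by (simp add: real_input_def coef_list_def coef_row_def[abs_def])

lemma memory_real_input:
  shows "e < d * d \<Longrightarrow> k < n \<Longrightarrow>
      memory (real_input n d C X) (e * n + k) = lookup (X $$ (e div d, e mod d)) (single k 1)"
    and "t < length C \<Longrightarrow> memory (real_input n d C X) (d * d * n + t) = gate_scalar (C ! t)"
    and "d * d * n + length C \<le> x \<Longrightarrow> memory (real_input n d C X) x = 0"
proof -
  assume "e < d * d" "k < n"
  then show "memory (real_input n d C X) (e * n + k) = lookup (X $$ (e div d, e mod d)) (single k 1)"
    using index_less_mult[of e "d * d" k n]
    by (simp add: memory_def real_input_eq nth_append length_coef_list coef_list_nth)
qed (simp_all add: memory_def real_input_eq nth_append length_coef_list)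

definition sel_gate :: "circuit \<Rightarrow> nat \<Rightarrow> nat" where
  "sel_gate C t = (if gate_type C t > 2
     then if gate_type C (gate_op1 C t) > 1 then gate_op2 C t else gate_op1 C t else t)"

definition sel_row :: "circuit \<Rightarrow> nat \<Rightarrow> nat" where
  "sel_row C t = (if gate_type C t > 2
     then if gate_type C (gate_op1 C t) > 1 then Suc (gate_op1 C t) else Suc (gate_op2 C t) else 0)"

lemma is_input_gate_type: "is_input (C ! t) \<longleftrightarrow> gate_type C t \<le> 1"
  by (cases "C ! t") (simp_all add: gate_type_def)

lemma gate_polys_input:
  assumes "wf_circuit n C" "t < length C" "is_input (C ! t)"
  shows "gate_polys C ! t =
      (if gate_type C t = 0 then PVar (gate_op1 C t) else PConst (gate_scalar (C ! t)))"
    and "gate_type C t = 0 \<Longrightarrow> gate_op1 C t < n"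
proof -
  have wf: "wf_gate n t (C ! t)" if "t < length C" for t
    using assms(1) that by (simp add: wf_circuit_def)
  show "gate_polys C ! t =
      (if gate_type C t = 0 then PVar (gate_op1 C t) else PConst (gate_scalar (C ! t)))"
    using gate_polys_nth[OF wf assms(2)] assms(3)
    by (cases "C ! t") (simp_all add: gate_type_def gate_op1_def)
  show "gate_op1 C t < n" if "gate_type C t = 0"
    using wf[OF assms(2)] that by (cases "C ! t") (simp_all add: gate_type_def gate_op1_def)
qed

lemma gate_ops_less:
  assumes "wf_circuit n C" "t < length C" "gate_type C t \<ge> 2"
  shows "gate_op1 C t < t" "gate_op2 C t < t"
  using assms unfolding wf_circuit_def
  by (cases "C ! t"; force simp: gate_type_def gate_op1_def gate_op2_def)+

text \<open>Skewness enters here: if the first operand is not an input, the second one is, and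
  commutativity puts the input factor in front. The leading 1 is row 0, against which a lone input
  gate is multiplied.\<close>

lemma gate_polys_mul:
  assumes wf: "wf_circuit n C" and "skew C" and t: "t < length C" and ty: "gate_type C t \<noteq> 2"
  shows "is_input (C ! sel_gate C t) \<and> sel_gate C t < length C \<and>
    gate_polys C ! t = gate_polys C ! sel_gate C t * (1 # gate_polys C) ! sel_row C t"
proof (cases "C ! t")
  case (GMul l r)
  have "l < t" "r < t" using wf t GMul by (auto simp: wf_circuit_def dest: spec[of _ t])
  moreover have "is_input (C ! l) \<or> is_input (C ! r)"
    using \<open>skew C\<close> t GMul unfolding skew_def by (metis nth_mem)
  moreover have "gate_polys C ! t = gate_polys C ! l * gate_polys C ! r"
    using gate_polys_nth[of C n t] wf t GMul by (simp add: wf_circuit_def)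
  moreover have "gate_type C t = 3" "gate_op1 C t = l" "gate_op2 C t = r"
    using GMul by (simp_all add: gate_type_def gate_op1_def gate_op2_def)
  ultimately show ?thesis
    using t by (auto simp: sel_gate_def sel_row_def is_input_gate_type mult.commute)
qed (use t ty in \<open>simp_all add: sel_gate_def sel_row_def gate_type_def\<close>)

lemma gate_polys_add:
  assumes wf: "wf_circuit n C" and t: "t < length C" and ty: "gate_type C t = 2"
  shows "gate_polys C ! t = gate_polys C ! gate_op1 C t + gate_polys C ! gate_op2 C t"
  using gate_polys_nth[of C n t] assms
  by (cases "C ! t") (simp_all add: wf_circuit_def gate_type_def gate_op1_def gate_op2_def)

lemma runs_program_apolar:
  assumes wf: "wf_circuit n C" and "skew C" and X: "X \<in> carrier_mat d d"
    and lin: "\<And>i j. i < d \<Longrightarrow> j < d \<Longrightarrow> X $$ (i, j) \<in> forms n 1"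
  shows "runs program (input_state n d C X) (length C * 4 ^ d * (2 * d * d + 1))
    (\<lambda>s. result s = apolar (det X) (last (gate_polys C)))"
proof -
  let ?polys = "1 # gate_polys C"
  define V where "V r p = apolar (mask_minor d X p) (?polys ! r)" for r p
  define coef where "coef e k = lookup (X $$ (e div d, e mod d)) (single k 1)" for e k
  define scal where "scal t = gate_scalar (C ! t)" for t
  interpret table_spec n d "length C" "gate_type C" "gate_op1 C" "gate_op2 C" coef scal V
    "sel_gate C" "sel_row C"
  proof
    \<comment> \<open>Pairing with the polynomial 1 extracts the constant coefficient of the
      minor.\<close>
    show "V 0 p = (if p = 0 then 1 else 0)" if "p < 4 ^ d" for p
      using lookup_mask_minor_0[OF lin that] by (simp add: V_def apolar_1_right)
    show "gate_op1 C t < t \<and> gate_op2 C t < t" if "t < length C" "2 \<le> gate_type C t" for t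
      using gate_ops_less[OF wf that] by simp
    show "V (Suc t) p = V (Suc (gate_op1 C t)) p + V (Suc (gate_op2 C t)) p"
      if "t < length C" "gate_type C t = 2" for t p
      using gate_polys_add[OF wf that] by (simp add: V_def apolar_add_right)
    show "V (Suc t) p = scal (sel_gate C t) * V (sel_row C t) p"
      if "t < length C" "gate_type C t \<noteq> 2" "gate_type C (sel_gate C t) \<noteq> 0" for t p
      using gate_polys_mul[OF wf \<open>skew C\<close> that(1,2)] gate_polys_input(1)[OF wf, of "sel_gate C t"] that(3)
      by (simp add: V_def scal_def apolar_PConst_mult_right)
    show "gate_op1 C (sel_gate C t) < n \<and>
        V (Suc t) p = (\<Sum>e<d * d. if bit p (d + e div d) \<and> bit p (e mod d) then
        (- 1) ^ (popcount (p div 2 ^ d mod 2 ^ (e div d)) + popcount (p mod 2 ^ (e mod d))) *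
        (coef e (gate_op1 C (sel_gate C t)) *
          V (sel_row C t) (p - 2 ^ (d + e div d) - 2 ^ (e mod d))) else 0)"
      if t: "t < length C" "gate_type C t \<noteq> 2" "gate_type C (sel_gate C t) = 0" for t p
    proof
      note mul = gate_polys_mul[OF wf \<open>skew C\<close> t(1,2)]
      show "gate_op1 C (sel_gate C t) < n"
        using gate_polys_input(2)[OF wf _ _ t(3)] mul by simp
      have "V (Suc t) p = apolar (mask_minor d X p)
          (PVar (gate_op1 C (sel_gate C t)) * ?polys ! sel_row C t)"
        using gate_polys_input(1)[OF wf, of "sel_gate C t"] mul t(3) by (simp add: V_def)
      also have "\<dots> = (\<Sum>e<d * d. if bit p (d + e div d) \<and> bit p (e mod d) then
        (- 1) ^ (popcount (p div 2 ^ d mod 2 ^ (e div d)) + popcount (p mod 2 ^ (e mod d))) *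
        (coef e (gate_op1 C (sel_gate C t)) *
          V (sel_row C t) (p - 2 ^ (d + e div d) - 2 ^ (e mod d))) else 0)"
        unfolding V_def coef_def
        by (rule apolar_mask_minor_PVar[of d X n, unfolded sum_less_square]) (rule lin)
      finally show "V (Suc t) p = \<dots>" .
    qed
  qed (simp_all add: sel_gate_def sel_row_def)
  have "runs program (input_state n d C X) (length C * 4 ^ d * (2 * d * d + 1))
    (\<lambda>s. snd s 0 = V (length C) (4 ^ d - 1))"
  proof (rule runs_program)
    show "nat_ok (fst (input_state n d C X))"
      using memory_nat_input[of n d C] memory_nat_input_gate[of _ C 0 n d]
        memory_nat_input_gate[of _ C 1 n d] memory_nat_input_gate[of _ C 2 n d]
      by (simp add: nat_ok_def input_state_def gate_type_def gate_op1_def gate_op2_def)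
    show "fst (input_state n d C X) x = 0" if "N \<le> x" for x
      using that by (simp add: input_state_def memory_def length_nat_input N_def)
    show "real_ok (snd (input_state n d C X))"
      by (simp add: real_ok_def input_state_def memory_real_input coef_def scal_def)
    show "snd (input_state n d C X) x = 0" if "B \<le> x" for x
      using that by (simp add: input_state_def memory_real_input B_def)
  qed
  moreover have "V (length C) (4 ^ d - 1) = apolar (det X) (last (gate_polys C))"
  proof -
    have "C \<noteq> []" using wf by (simp add: wf_circuit_def)
    \<comment> \<open>The leading 1 shifts positions by one, so index \<open>length C\<close>
      reaches the last gate.\<close>
    then have "last (gate_polys C) = ?polys ! length C"
      using length_gate_polys[of C] by (subst last_conv_nth) (auto simp: nth_Cons')
    then show ?thesis by (simp only: V_def mask_minor_full[OF X])
  qed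
  ultimately show ?thesis by (simp add: result_def)
qed

theorem theorem1:
  shows "\<exists>(P :: com) (p :: nat poly).
    \<forall>(n :: nat) (d :: nat) (C :: circuit) (g :: mpoly) (X :: mpoly mat).
      wf_circuit n C \<and> skew C \<and> computes C g \<and> g \<in> forms n d \<and>
      X \<in> carrier_mat d d \<and> (\<forall>i<d. \<forall>j<d. X $$ (i, j) \<in> forms n 1) \<longrightarrow>
      (\<exists>k s. exec P (input_state n d C X) k s \<and>
             result s = apolar (det X) g \<and>
             k \<le> 4 ^ d * length C * poly p d)"
\<comment> \<open>The polynomial is \<open>1 + 2 d\<^sup>2\<close>, the cost bound of one table
  cell.\<close>
proof (intro exI[of _ program] exI[of _ "[:1, 0, 2:]"] allI impI)
  fix n d C g X
  assume "wf_circuit n C \<and> skew C \<and> computes C g \<and> g \<in> forms n d \<and>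
      X \<in> carrier_mat d d \<and> (\<forall>i<d. \<forall>j<d. X $$ (i, j) \<in> forms n 1)"
  then have "runs program (input_state n d C X) (length C * 4 ^ d * (2 * d * d + 1))
      (\<lambda>s. result s = apolar (det X) g)"
    using runs_program_apolar[of n C X d] by (simp add: computes_def)
  moreover have "length C * 4 ^ d * (2 * d * d + 1) = 4 ^ d * length C * poly [:1, 0, 2:] d"
    by (simp add: algebra_simps)
  ultimately show "\<exists>k s. exec program (input_state n d C X) k s \<and>
      result s = apolar (det X) g \<and> k \<le> 4 ^ d * length C * poly [:1, 0, 2:] d"
    unfolding runs_def by metis
qed

end
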